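(* Let $R:S^1\to\mathbb{R}$ satisfy the standing assumptions in the context, and let $p\in\mathcal{P}$ be odd. Let $V\subset\mathcal{H}_{\mathrm{RAQ}}^{p}$ be a linear subspace invariant under $\mathcal{A}_{\mathrm{obs}}$, $V\ne\{0\}$. Then $V=\mathcal{H}_{\mathrm{RAQ}}^{p}$.
   Context: $S^1=\mathbb{R}/2\pi\mathbb{Z}$, and $\mathcal{C}=S^1\times S^1$ has coordinates $(x,y)$. Standing assumptions on $R:S^1\to\mathbb{R}$: $R$ is smooth, is positive somewhere, has at most finitely many stationary points (points with $R'=0$), at each stationary point some derivative of $R$ (of order $\ge 1$) is nonvanishing, no zero of $R$ is a stationary point, the equation $q^2=R(y)$ has a solution for some non-negative integer $q$, and the set $\mathcal{P}$ defined below has the property: if $p\in\mathcal{P}$, then $\mathcal{P}$ contains no factors (positive divisors) of $p$ smaller than $p/2$. $\mathcal{H}_{\mathrm{aux}}=L^2(\mathcal{C},dx\,dy)$. The constraint operator $\hat C=-\partial^2/\partial x^2-R(y)$ is essentially self-adjoint, and $U(t):=e^{-it\hat C}$, $t\in\mathbb{R}$. The test space $\Phi\subset\mathcal{H}_{\mathrm{aux}}$ is the dense subspace of functions $f(x,y)=\sum_{m\in\mathbb{Z}}e^{imx}f_m(y)$ with each $f_m:S^1\to\mathbb{C}$ smooth and only finitely many $f_m$ nonzero. It is invariant under $U(t)$: $(U(t)f)(x,y)=\sum_m e^{-it[m^2-R(y)]}e^{imx}f_m(y)$. $\Phi^*$ is the algebraic dual of $\Phi$; $\xi[g]$ denotes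 the action of $\xi\in\Phi^*$ on $g\in\Phi$. $\mathcal{A}_{\mathrm{obs}}$ is the algebra of (linear, densely defined) operators $\mathcal{O}$ on $\mathcal{H}_{\mathrm{aux}}$ such that the domains of $\mathcal{O}$ and its adjoint $\mathcal{O}^\dagger$ include $\Phi$, both $\mathcal{O}$ and $\mathcal{O}^\dagger$ map $\Phi$ into $\Phi$, and $\mathcal{O}$ commutes with $U(t)$ on $\Phi$ for all $t\in\mathbb{R}$. For a non-negative integer $q$ and a solution $y$ of $q^2=R(y)$, the order of $y$ is the order $p\ge1$ of the lowest nonvanishing derivative (of order $\ge1$) of $R$ at $y$. For odd $p$, $Y_p(q)$ is the (finite) set of solutions of $q^2=R(y)$ of order $p$. $\mathcal{P}$ is the set of all orders occurring for solutions of $q^2=R(y)$, over all non-negative integers $q$. For odd $p\in\mathcal{P}$ the antilinear map $\eta_p:\Phi\to\Phi^*$ is $$\eta_p(f)[g]=(2\pi)^2\sum_{m\in\mathbb{Z}}\sum_{y\in Y_p(|m|)}\frac{\overline{f_m(y)}\,g_m(y)}{|R^{(p)}(y)|^{1/p}},\qquad f,g\in\Phi .$$ It satisfies $\eta_p(\mathcal{O}f)[g]=\eta_p(f)[\mathcal{O}^\dagger g]$ for all $\mathcal{O}\in\mathcal{A}_{\mathrm{obs}}$, $f,g\in\Phi$. $\mathcal{H}_{\mathrm{RAQ}}^{p}:=\eta_p(\Phi)$ is the (finite-dimensional) Hilbert space with inner product $(\eta_p(\phi_1),\eta_p(\phi_2))_{\mathrm{RAQ}}:=\eta_p(\phi_2)[\phi_1]$,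 and $\mathcal{O}\in\mathcal{A}_{\mathrm{obs}}$ acts on it by $\eta_p(\phi)\mapsto\eta_p(\mathcal{O}\phi)$. A subspace $V$ is invariant under $\mathcal{A}_{\mathrm{obs}}$ if $\eta_p(\phi)\in V$ implies $\eta_p(\mathcal{O}\phi)\in V$ for all $\mathcal{O}\in\mathcal{A}_{\mathrm{obs}}$. *)

theory Defs
  imports "HOL-Analysis.Analysis" "HOL-Library.Function_Algebras"
begin

text \<open>
  Functions on the circle are \<open>2 * pi\<close>-periodic functions on the real line.  For integration, and
  for sets of points of the circle, the fundamental domain \<open>{0..<2 * pi}\<close> is used.
\<close>

definition torus :: "(real \<times> real) measure" where
  "torus = restrict_space lborel ({0..<2 * pi} \<times> {0..<2 * pi})"

definition square_integrable :: "(real \<times> real \<Rightarrow> complex) \<Rightarrow> bool" where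
  "square_integrable f \<longleftrightarrow> f \<in> borel_measurable torus \<and> integrable torus (\<lambda>z. (cmod (f z))\<^sup>2)"

definition L2_eq :: "(real \<times> real \<Rightarrow> complex) \<Rightarrow> (real \<times> real \<Rightarrow> complex) \<Rightarrow> bool" where
  "L2_eq f g \<longleftrightarrow> square_integrable f \<and> square_integrable g \<and> (AE z in torus. f z = g z)"

lemma square_integrable_zero: "square_integrable (\<lambda>z. 0)"
  by (simp add: square_integrable_def)

lemma square_integrable_mult_integrable:
  assumes "square_integrable f" "square_integrable g"
  shows "integrable torus (\<lambda>z. cnj (f z) * g z)"
proof (rule Bochner_Integration.integrable_bound)
  show "integrable torus (\<lambda>z. (cmod (f z))\<^sup>2 + (cmod (g z))\<^sup>2)"
    using assms by (auto simp: square_integrable_def)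
  show "(\<lambda>z. cnj (f z) * g z) \<in> borel_measurable torus"
    using assms measurable_compose[OF _ borel_measurable_continuous_onI[OF continuous_on_cnj[OF continuous_on_id]], of f torus]
    by (intro borel_measurable_times) (simp_all add: square_integrable_def)
  show "AE z in torus. norm (cnj (f z) * g z) \<le> norm ((cmod (f z))\<^sup>2 + (cmod (g z))\<^sup>2)"
  proof (rule AE_I2)
    fix z
    have "2 * (cmod (f z) * cmod (g z)) \<le> (cmod (f z))\<^sup>2 + (cmod (g z))\<^sup>2"
      using sum_squares_bound[of "cmod (f z)" "cmod (g z)"] by (simp add: mult.assoc)
    moreover have "0 \<le> cmod (f z) * cmod (g z)" by simp
    ultimately have "cmod (f z) * cmod (g z) \<le> (cmod (f z))\<^sup>2 + (cmod (g z))\<^sup>2" by linarith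
    then show "norm (cnj (f z) * g z) \<le> norm ((cmod (f z))\<^sup>2 + (cmod (g z))\<^sup>2)"
      by (simp add: norm_mult)
  qed
qed

lemma square_integrable_scale:
  assumes "square_integrable f" shows "square_integrable (\<lambda>z. c * f z)"
  using assms by (auto simp: square_integrable_def norm_mult power_mult_distrib)

lemma square_integrable_add:
  assumes "square_integrable f" "square_integrable g"
  shows "square_integrable (\<lambda>z. f z + g z)"
proof -
  have m: "f \<in> borel_measurable torus" "g \<in> borel_measurable torus"
    using assms by (auto simp: square_integrable_def)
  have "integrable torus (\<lambda>z. (cmod (f z + g z))\<^sup>2)"
  proof (rule Bochner_Integration.integrable_bound)
    show "integrable torus (\<lambda>z. 2 * (cmod (f z))\<^sup>2 + 2 * (cmod (g z))\<^sup>2)"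
      using assms by (auto simp: square_integrable_def)
    show "(\<lambda>z. (cmod (f z + g z))\<^sup>2) \<in> borel_measurable torus" using m by measurable
    show "AE z in torus. norm ((cmod (f z + g z))\<^sup>2) \<le> norm (2 * (cmod (f z))\<^sup>2 + 2 * (cmod (g z))\<^sup>2)"
    proof (rule AE_I2)
      fix z
      have "(cmod (f z + g z))\<^sup>2 \<le> (cmod (f z) + cmod (g z))\<^sup>2"
        by (rule power_mono[OF norm_triangle_ineq]) simp
      also have "\<dots> \<le> 2 * (cmod (f z))\<^sup>2 + 2 * (cmod (g z))\<^sup>2"
        using sum_squares_bound[of "cmod (f z)" "cmod (g z)"] by (simp add: power2_sum)
      finally show "norm ((cmod (f z + g z))\<^sup>2) \<le> norm (2 * (cmod (f z))\<^sup>2 + 2 * (cmod (g z))\<^sup>2)"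
        by simp
    qed
  qed
  then show ?thesis using m by (auto simp: square_integrable_def)
qed

quotient_type L2_torus = "real \<times> real \<Rightarrow> complex" / partial: L2_eq
  morphisms rep_L2 to_L2
proof (rule part_equivpI)
  show "\<exists>f. L2_eq f f"
    by (rule exI[of _ "\<lambda>z. 0"]) (simp add: L2_eq_def square_integrable_zero)
  show "symp L2_eq" by (auto simp: symp_def L2_eq_def eq_commute)
  show "transp L2_eq" by (auto simp: transp_def L2_eq_def)
qed

lift_definition cinner_L2 :: "L2_torus \<Rightarrow> L2_torus \<Rightarrow> complex"
  is "\<lambda>f g. \<integral>z. cnj (f z) * g z \<partial>torus"
proof -
  fix f f' g g' assume "L2_eq f f'" "L2_eq g g'"
  then show "(\<integral>z. cnj (f z) * g z \<partial>torus) = (\<integral>z. cnj (f' z) * g' z \<partial>torus)"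
    by (intro integral_cong_AE borel_measurable_integrable square_integrable_mult_integrable)
      (auto simp: L2_eq_def)
qed

lift_definition scaleC_L2 :: "complex \<Rightarrow> L2_torus \<Rightarrow> L2_torus" is "\<lambda>c f z. c * f z"
  by (auto simp: L2_eq_def intro: square_integrable_scale)

instantiation L2_torus :: real_inner
begin

lift_definition zero_L2_torus :: L2_torus is "\<lambda>z. 0"
  by (simp add: L2_eq_def square_integrable_zero)

lift_definition plus_L2_torus :: "L2_torus \<Rightarrow> L2_torus \<Rightarrow> L2_torus" is "\<lambda>f g z. f z + g z"
  by (auto simp: L2_eq_def intro: square_integrable_add)

definition scaleR_L2_torus :: "real \<Rightarrow> L2_torus \<Rightarrow> L2_torus" where
  "scaleR_L2_torus r f = scaleC_L2 (complex_of_real r) f"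

definition uminus_L2_torus :: "L2_torus \<Rightarrow> L2_torus" where
  "uminus_L2_torus f = scaleC_L2 (- 1) f"

definition minus_L2_torus :: "L2_torus \<Rightarrow> L2_torus \<Rightarrow> L2_torus" where
  "minus_L2_torus f g = f + - (g :: L2_torus)"

definition inner_L2_torus :: "L2_torus \<Rightarrow> L2_torus \<Rightarrow> real" where
  "inner_L2_torus f g = Re (cinner_L2 f g)"

definition norm_L2_torus :: "L2_torus \<Rightarrow> real" where
  "norm_L2_torus f = sqrt (f \<bullet> f)"

definition sgn_L2_torus :: "L2_torus \<Rightarrow> L2_torus" where
  "sgn_L2_torus f = scaleR (inverse (norm f)) f"

definition dist_L2_torus :: "L2_torus \<Rightarrow> L2_torus \<Rightarrow> real" where
  "dist_L2_torus f g = norm (f - g)"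

definition uniformity_L2_torus :: "(L2_torus \<times> L2_torus) filter" where
  "uniformity_L2_torus = (INF e\<in>{0<..}. principal {(f, g). dist f g < e})"

definition open_L2_torus :: "L2_torus set \<Rightarrow> bool" where
  "open_L2_torus S \<longleftrightarrow> (\<forall>f\<in>S. \<forall>\<^sub>F (f', g) in uniformity. f' = f \<longrightarrow> g \<in> S)"

instance
proof
  fix a b c :: L2_torus and r s :: real
  show "a + b + c = a + (b + c)"
    by transfer (auto simp: L2_eq_def add.assoc intro!: square_integrable_add)
  show "a + b = b + a"
    by transfer (auto simp: L2_eq_def add.commute intro!: square_integrable_add)
  show "0 + a = a" by transfer (auto simp: L2_eq_def)
  show "- a + a = 0"
    unfolding uminus_L2_torus_def
    by transfer (auto simp: L2_eq_def square_integrable_zero)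
  show "a - b = a + - b" by (simp add: minus_L2_torus_def)
  show "r *\<^sub>R (a + b) = r *\<^sub>R a + r *\<^sub>R b"
    unfolding scaleR_L2_torus_def
    by transfer (auto simp: L2_eq_def distrib_left distrib_right
        intro!: square_integrable_add square_integrable_scale)
  show "(r + s) *\<^sub>R a = r *\<^sub>R a + s *\<^sub>R a"
    unfolding scaleR_L2_torus_def
    by transfer (auto simp: L2_eq_def distrib_left distrib_right
        intro!: square_integrable_add square_integrable_scale)
  show "r *\<^sub>R s *\<^sub>R a = (r * s) *\<^sub>R a"
    unfolding scaleR_L2_torus_def
    by transfer (auto simp: L2_eq_def mult.assoc intro!: square_integrable_scale)
  show "1 *\<^sub>R a = a"
    unfolding scaleR_L2_torus_def by transfer (auto simp: L2_eq_def)
  show "dist a b = norm (a - b)" by (rule dist_L2_torus_def)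
  show "sgn a = scaleR (inverse (norm a)) a" by (rule sgn_L2_torus_def)
  show "uniformity = (INF e\<in>{0<..}. principal {(f, g :: L2_torus). dist f g < e})"
    by (rule uniformity_L2_torus_def)
  show "open S \<longleftrightarrow> (\<forall>f\<in>S. \<forall>\<^sub>F (f', g) in uniformity. f' = f \<longrightarrow> g \<in> S)" for S :: "L2_torus set"
    by (rule open_L2_torus_def)
  show "norm a = sqrt (a \<bullet> a)" by (rule norm_L2_torus_def)
  show "a \<bullet> b = b \<bullet> a"
    unfolding inner_L2_torus_def
  proof transfer
    fix f g assume "L2_eq f f" "L2_eq g g"
    then have i: "integrable torus (\<lambda>z. cnj (g z) * f z)"
      by (intro square_integrable_mult_integrable) (auto simp: L2_eq_def)
    have "(\<integral>z. cnj (f z) * g z \<partial>torus) = cnj (\<integral>z. cnj (g z) * f z \<partial>torus)"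
      by (simp add: mult.commute flip: Bochner_Integration.integral_cnj)
    then show "Re (\<integral>z. cnj (f z) * g z \<partial>torus) = Re (\<integral>z. cnj (g z) * f z \<partial>torus)" by simp
  qed
  show "(a + b) \<bullet> c = a \<bullet> c + b \<bullet> c"
    unfolding inner_L2_torus_def
  proof transfer
    fix f g h assume "L2_eq f f" "L2_eq g g" "L2_eq h h"
    then have "integrable torus (\<lambda>z. cnj (f z) * h z)" "integrable torus (\<lambda>z. cnj (g z) * h z)"
      by (auto intro!: square_integrable_mult_integrable simp: L2_eq_def)
    then show "Re (\<integral>z. cnj (f z + g z) * h z \<partial>torus) =
        Re (\<integral>z. cnj (f z) * h z \<partial>torus) + Re (\<integral>z. cnj (g z) * h z \<partial>torus)"
      by (simp add: distrib_right)
  qed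
  show "r *\<^sub>R a \<bullet> b = r * (a \<bullet> b)"
    unfolding inner_L2_torus_def scaleR_L2_torus_def
    by transfer (simp add: mult.assoc)
  have sq: "cnj w * w = complex_of_real ((cmod w)\<^sup>2)" for w
    by (simp only: complex_norm_square mult.commute)
  show "0 \<le> a \<bullet> a"
    unfolding inner_L2_torus_def
    by transfer (simp add: sq del: of_real_power)
  show "a \<bullet> a = 0 \<longleftrightarrow> a = 0"
    unfolding inner_L2_torus_def
  proof transfer
    fix f assume f: "L2_eq f f"
    then have "(\<integral>z. (cmod (f z))\<^sup>2 \<partial>torus) = 0 \<longleftrightarrow> (AE z in torus. (cmod (f z))\<^sup>2 = 0)"
      by (intro integral_nonneg_eq_0_iff_AE) (auto simp: L2_eq_def square_integrable_def)
    then show "Re (\<integral>z. cnj (f z) * f z \<partial>torus) = 0 \<longleftrightarrow> L2_eq f (\<lambda>z. 0)"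
      using f by (simp add: sq L2_eq_def square_integrable_zero del: of_real_power)
  qed
qed

end

interpretation cL2: vector_space scaleC_L2
proof
  fix a b :: complex and f g :: L2_torus
  show "scaleC_L2 a (f + g) = scaleC_L2 a f + scaleC_L2 a g"
    by transfer (auto simp: L2_eq_def distrib_left distrib_right
        intro!: square_integrable_add square_integrable_scale)
  show "scaleC_L2 (a + b) f = scaleC_L2 a f + scaleC_L2 b f"
    by transfer (auto simp: L2_eq_def distrib_left distrib_right
        intro!: square_integrable_add square_integrable_scale)
  show "scaleC_L2 a (scaleC_L2 b f) = scaleC_L2 (a * b) f"
    by transfer (auto simp: L2_eq_def mult.assoc intro!: square_integrable_scale)
  show "scaleC_L2 1 f = f" by transfer (auto simp: L2_eq_def)
qed

definition nth_deriv :: "nat \<Rightarrow> (real \<Rightarrow> 'a::real_normed_vector) \<Rightarrow> real \<Rightarrow> 'a" where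
  "nth_deriv n f = ((\<lambda>h y. vector_derivative h (at y)) ^^ n) f"

definition smooth_circle :: "(real \<Rightarrow> 'a::real_normed_vector) \<Rightarrow> bool" where
  "smooth_circle f \<longleftrightarrow> (\<forall>y. f (y + 2 * pi) = f y) \<and> (\<forall>n y. nth_deriv n f differentiable at y)"

definition test_modes :: "(int \<Rightarrow> real \<Rightarrow> complex) set" where
  "test_modes = {F. (\<forall>m. smooth_circle (F m)) \<and> finite {m. F m \<noteq> (\<lambda>y. 0)}}"

definition mode_sum :: "(int \<Rightarrow> real \<Rightarrow> complex) \<Rightarrow> real \<times> real \<Rightarrow> complex" where
  "mode_sum F = (\<lambda>(x, y). \<Sum>m | F m \<noteq> (\<lambda>y. 0). exp (\<i> * of_int m * of_real x) * F m y)"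

definition test_space :: "L2_torus set"  ("\<Phi>") where
  "\<Phi> = (\<lambda>F. to_L2 (mode_sum F)) ` test_modes"

text \<open>
  The smooth coefficients of an element of the test space are unique, since continuous functions
  that agree almost everywhere agree.
\<close>

definition modes :: "L2_torus \<Rightarrow> int \<Rightarrow> real \<Rightarrow> complex" where
  "modes f = (THE F. F \<in> test_modes \<and> to_L2 (mode_sum F) = f)"

definition constraint_fun :: "(real \<Rightarrow> real) \<Rightarrow> (real \<times> real \<Rightarrow> complex) \<Rightarrow> real \<times> real \<Rightarrow> complex" where
  "constraint_fun R f = (\<lambda>(x, y). - nth_deriv 2 (\<lambda>s. f (s, y)) x - of_real (R y) * f (x, y))"

text \<open>The operator \<open>- d^2/dx^2 - R(y)\<close> is essentially self-adjoint with domain \<open>\<Phi>\<close>, so the closure of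
  its graph is the graph of its unique self-adjoint extension.\<close>

definition constraint_graph :: "(real \<Rightarrow> real) \<Rightarrow> (L2_torus \<times> L2_torus) set" where
  "constraint_graph R =
    (\<lambda>F. (to_L2 (mode_sum F), to_L2 (constraint_fun R (mode_sum F)))) ` test_modes"

definition unitary_L2 :: "(L2_torus \<Rightarrow> L2_torus) \<Rightarrow> bool" where
  "unitary_L2 W \<longleftrightarrow> Vector_Spaces.linear scaleC_L2 scaleC_L2 W \<and> surj W \<and>
     (\<forall>f g. cinner_L2 (W f) (W g) = cinner_L2 f g)"

definition unitary_group :: "(real \<Rightarrow> L2_torus \<Rightarrow> L2_torus) \<Rightarrow> bool" where
  "unitary_group U \<longleftrightarrow> (\<forall>t. unitary_L2 (U t)) \<and> U 0 = id \<and> (\<forall>s t. U (s + t) = U s \<circ> U t) \<and>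
     (\<forall>f. continuous_on UNIV (\<lambda>t. U t f))"

text \<open>
  By Stone's theorem, for a self-adjoint operator with graph \<open>A\<close> there is exactly one strongly
  continuous unitary group with \<open>U t = exp (- \<i> * t * A)\<close>: the one whose derivative at \<open>0\<close> exists
  precisely on the domain of the operator and is \<open>- \<i>\<close> times the operator there.
\<close>

definition generated_by :: "(real \<Rightarrow> L2_torus \<Rightarrow> L2_torus) \<Rightarrow> (L2_torus \<times> L2_torus) set \<Rightarrow> bool" where
  "generated_by U A \<longleftrightarrow> unitary_group U \<and>
     A = {(f, h). ((\<lambda>t. U t f) has_vector_derivative scaleC_L2 (- \<i>) h) (at 0)}"

definition constraint_evolution :: "(real \<Rightarrow> real) \<Rightarrow> (real \<Rightarrow> L2_torus \<Rightarrow> L2_torus) \<Rightarrow> bool" where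
  "constraint_evolution R U \<longleftrightarrow> generated_by U (closure (constraint_graph R))"

text \<open>An operator is a domain together with a function whose values off the domain are irrelevant.\<close>

type_synonym operator = "L2_torus set \<times> (L2_torus \<Rightarrow> L2_torus)"

definition densely_defined_operator :: "operator \<Rightarrow> bool" where
  "densely_defined_operator = (\<lambda>(D, A). cL2.subspace D \<and> closure D = UNIV \<and>
     (\<forall>f\<in>D. \<forall>g\<in>D. A (f + g) = A f + A g) \<and> (\<forall>c. \<forall>f\<in>D. A (scaleC_L2 c f) = scaleC_L2 c (A f)))"

definition adjoint_op :: "operator \<Rightarrow> operator" where
  "adjoint_op = (\<lambda>(D, A).
     ({h. \<exists>k. \<forall>f\<in>D. cinner_L2 h (A f) = cinner_L2 k f},
      \<lambda>h. THE k. \<forall>f\<in>D. cinner_L2 h (A f) = cinner_L2 k f))"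

definition observables :: "(real \<Rightarrow> L2_torus \<Rightarrow> L2_torus) \<Rightarrow> operator set" where
  "observables U = {Q. densely_defined_operator Q \<and>
     \<Phi> \<subseteq> fst Q \<and> \<Phi> \<subseteq> fst (adjoint_op Q) \<and>
     snd Q ` \<Phi> \<subseteq> \<Phi> \<and> snd (adjoint_op Q) ` \<Phi> \<subseteq> \<Phi> \<and>
     (\<forall>t. \<forall>f\<in>\<Phi>. snd Q (U t f) = U t (snd Q f))}"

definition point_order :: "(real \<Rightarrow> real) \<Rightarrow> real \<Rightarrow> nat" where
  "point_order R y = (LEAST n. 1 \<le> n \<and> nth_deriv n R y \<noteq> 0)"

definition solutions :: "(real \<Rightarrow> real) \<Rightarrow> nat \<Rightarrow> nat \<Rightarrow> real set" where
  "solutions R p q = {y \<in> {0..<2 * pi}. (real q)\<^sup>2 = R y \<and> point_order R y = p}"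

definition orders :: "(real \<Rightarrow> real) \<Rightarrow> nat set" where
  "orders R = {p. \<exists>q. solutions R p q \<noteq> {}}"

definition admissible_potential :: "(real \<Rightarrow> real) \<Rightarrow> bool" where
  "admissible_potential R \<longleftrightarrow>
     smooth_circle R \<and>
     (\<exists>y. R y > 0) \<and>
     finite {y \<in> {0..<2 * pi}. nth_deriv 1 R y = 0} \<and>
     (\<forall>y. nth_deriv 1 R y = 0 \<longrightarrow> (\<exists>n\<ge>1. nth_deriv n R y \<noteq> 0)) \<and>
     (\<forall>y. R y = 0 \<longrightarrow> nth_deriv 1 R y \<noteq> 0) \<and>
     (\<exists>(q::nat) y. (real q)\<^sup>2 = R y) \<and>
     (\<forall>p\<in>orders R. \<not> (\<exists>d\<in>orders R. d dvd p \<and> real d < real p / 2))"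

text \<open>
  Elements of the algebraic dual of \<open>\<Phi>\<close> are represented as functions on the whole Hilbert space
  that vanish off \<open>\<Phi>\<close>, so that equality of functionals is equality of functions.
\<close>

definition eta :: "(real \<Rightarrow> real) \<Rightarrow> nat \<Rightarrow> L2_torus \<Rightarrow> L2_torus \<Rightarrow> complex" where
  "eta R p f = (\<lambda>g. if g \<in> \<Phi> then
     of_real ((2 * pi)\<^sup>2) *
     (\<Sum>m | modes f m \<noteq> (\<lambda>y. 0). \<Sum>y\<in>solutions R p (nat \<bar>m\<bar>).
        cnj (modes f m y) * modes g m y / of_real (\<bar>nth_deriv p R y\<bar> powr (1 / real p)))
     else 0)"

definition H_RAQ :: "(real \<Rightarrow> real) \<Rightarrow> nat \<Rightarrow> (L2_torus \<Rightarrow> complex) set" where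
  "H_RAQ R p = eta R p ` \<Phi>"

interpretation functionals: vector_space "\<lambda>(c::complex) (\<xi> :: L2_torus \<Rightarrow> complex) g. c * \<xi> g"
  by unfold_locales (auto simp: fun_eq_iff algebra_simps)

definition observable_invariant ::
  "(real \<Rightarrow> real) \<Rightarrow> (real \<Rightarrow> L2_torus \<Rightarrow> L2_torus) \<Rightarrow> nat \<Rightarrow> (L2_torus \<Rightarrow> complex) set \<Rightarrow> bool" where
  "observable_invariant R U p V \<longleftrightarrow>
     (\<forall>Q\<in>observables U. \<forall>\<phi>\<in>\<Phi>. eta R p \<phi> \<in> V \<longrightarrow> eta R p (snd Q \<phi>) \<in> V)"

end

theory Submission
  imports Defs
begin

text \<open>
  A functional \<open>eta R p f\<close> is a combination of evaluations of modes \<open>n\<close> at points \<open>y\<close> of order \<open>p\<close> with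
  \<open>R y = n\<^sup>2\<close>, so it suffices to find, for any two such pairs \<open>(m, z)\<close> and \<open>(n, y)\<close>, an observable carrying
  a test function that does not vanish at \<open>(m, z)\<close> to one that vanishes at all these points except
  \<open>(n, y)\<close>.  As \<open>p\<close> is odd, \<open>root p (R - m\<^sup>2)\<close> and \<open>root p (R - n\<^sup>2)\<close> are smooth local coordinates at \<open>z\<close>
  and \<open>y\<close> by Hadamard's lemma.  The observable identifies the two coordinates, cut off near \<open>z\<close> and \<open>y\<close>;
  the Jacobians are distributed so that its adjoint is the same construction with the two points exchanged.
\<close>

section \<open>Smooth functions of one variable\<close>

text \<open>For odd \<open>p\<close> the function \<open>s \<mapsto> s ^ p\<close> is a bijection of
  the line, so near either point \<open>s\<close> takes both signs, and equal \<open>s\<close> means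
  \<open>R y - n^2 = R z - m^2\<close>; the common order \<open>p\<close> is what makes this one
  relation fit both points. Much of the work lies in the abstract setting. The adjoint of an
  operator is a definite description, so its value is pinned down only once \<Phi> is known to be
  dense; density is proved by Stone-Weierstrass on a product of two circles, followed by dominated
  convergence. Likewise \<open>U\<close> is given only through its generator, and commutation can be
  checked only after the explicit formula for \<open>U t\<close> on modes has been derived from it.
  The cutoffs must be smooth, periodic, supported in a short interval and nonzero at its centre.
  They are built from \<open>exp (- inverse x)\<close> composed with a cosine, which settles
  periodicity at no cost.\<close>

lemma nth_deriv_0 [simp]: "nth_deriv 0 f = f"
  by (simp add: nth_deriv_def)

lemma nth_deriv_Suc: "nth_deriv (Suc n) f = nth_deriv n (\<lambda>y. vector_derivative f (at y))"
  by (simp only: nth_deriv_def funpow_Suc_right o_apply)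

lemma nth_deriv_Suc': "nth_deriv (Suc n) f = (\<lambda>y. vector_derivative (nth_deriv n f) (at y))"
  by (simp add: nth_deriv_def)

lemma vector_derivative_cong_open:
  assumes "open S" "y \<in> S" "\<And>z. z \<in> S \<Longrightarrow> f z = g z"
  shows "vector_derivative f (at y) = vector_derivative g (at y)"
proof -
  have "(f has_vector_derivative d) (at y) \<longleftrightarrow> (g has_vector_derivative d) (at y)" for d
    using assms has_vector_derivative_transform_within_open[of f d y S g]
      has_vector_derivative_transform_within_open[of g d y S f] by auto
  then show ?thesis by (simp add: vector_derivative_def)
qed

lemma nth_deriv_cong_open:
  assumes "open S" "y \<in> S" "\<And>z. z \<in> S \<Longrightarrow> f z = g z"
  shows "nth_deriv n f y = nth_deriv n g y"
  using assms(2,3)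
proof (induction n arbitrary: f g)
  case (Suc n)
  show ?case unfolding nth_deriv_Suc
    by (rule Suc.IH[OF Suc.prems(1)], rule vector_derivative_cong_open[OF assms(1)]) (use Suc.prems in auto)
qed simp

text \<open>The closure properties below are inductions over the order: one differentiation of a
  product or a composition gives terms of the same kind with the order lowered by one. Counting with
  \<open>n < k\<close> leaves the base case empty. Differentiability is two-sided at each point, so
  \<open>S\<close> is usually open.\<close>

definition smooth_upto :: "nat \<Rightarrow> real set \<Rightarrow> (real \<Rightarrow> 'a::real_normed_vector) \<Rightarrow> bool" where
  "smooth_upto k S f \<longleftrightarrow> (\<forall>n<k. \<forall>y\<in>S. nth_deriv n f differentiable at y)"

definition smooth_on :: "real set \<Rightarrow> (real \<Rightarrow> 'a::real_normed_vector) \<Rightarrow> bool" where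
  "smooth_on S f \<longleftrightarrow> (\<forall>k. smooth_upto k S f)"

lemma smooth_on_iff: "smooth_on S f \<longleftrightarrow> (\<forall>n. \<forall>y\<in>S. nth_deriv n f differentiable at y)"
  by (auto simp: smooth_on_def smooth_upto_def)

lemma smooth_circle_iff: "smooth_circle f \<longleftrightarrow> (\<forall>y. f (y + 2 * pi) = f y) \<and> smooth_on UNIV f"
  by (auto simp: smooth_circle_def smooth_on_iff)

lemma smooth_upto_0 [simp]: "smooth_upto 0 S f"
  by (simp add: smooth_upto_def)

lemma smooth_upto_Suc:
  "smooth_upto (Suc k) S f \<longleftrightarrow>
    (\<forall>y\<in>S. f differentiable at y) \<and> smooth_upto k S (\<lambda>y. vector_derivative f (at y))"
  unfolding smooth_upto_def by (auto simp: All_less_Suc2 nth_deriv_Suc)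

lemma smooth_upto_SucD: "smooth_upto (Suc k) S f \<Longrightarrow> smooth_upto k S f"
  by (auto simp: smooth_upto_def)

lemma smooth_upto_mono: "smooth_upto k T f \<Longrightarrow> S \<subseteq> T \<Longrightarrow> smooth_upto k S f"
  by (auto simp: smooth_upto_def)

lemma smooth_on_mono: "smooth_on T f \<Longrightarrow> S \<subseteq> T \<Longrightarrow> smooth_on S f"
  by (auto simp: smooth_on_def intro: smooth_upto_mono)

lemma smooth_on_Un: "smooth_on S f \<Longrightarrow> smooth_on T f \<Longrightarrow> smooth_on (S \<union> T) f"
  by (auto simp: smooth_on_iff)

lemma smooth_upto_cong:
  assumes "open S" "\<And>y. y \<in> S \<Longrightarrow> f y = g y" "smooth_upto k S f"
  shows "smooth_upto k S g"
  unfolding smooth_upto_def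
proof (intro allI impI ballI)
  fix n y assume "n < k" "y \<in> S"
  then have "nth_deriv n f differentiable at y" using assms(3) by (auto simp: smooth_upto_def)
  then obtain D where D: "(nth_deriv n f has_derivative D) (at y)"
    by (auto simp: differentiable_def)
  have "(nth_deriv n g has_derivative D) (at y)"
    by (rule has_derivative_transform_within_open[OF D \<open>open S\<close> \<open>y \<in> S\<close>])
      (rule nth_deriv_cong_open[OF assms(1)], auto simp: assms(2))
  then show "nth_deriv n g differentiable at y" by (auto simp: differentiable_def)
qed

lemma smooth_on_cong:
  assumes "open S" "\<And>y. y \<in> S \<Longrightarrow> f y = g y" "smooth_on S f"
  shows "smooth_on S g"
  using assms smooth_upto_cong[OF assms(1,2)] by (auto simp: smooth_on_def)

text \<open>The derivative may be any function that is correct on \<open>S\<close>, because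
  \<open>S\<close> is open and higher derivatives only see values nearby. The inductions can thus
  work with explicit formulas instead of \<open>vector_derivative\<close>.\<close>

lemma smooth_upto_SucI:
  assumes "open S" "\<And>y. y \<in> S \<Longrightarrow> (f has_vector_derivative f' y) (at y)" "smooth_upto k S f'"
  shows "smooth_upto (Suc k) S f"
  unfolding smooth_upto_Suc
proof (intro conjI ballI)
  show "f differentiable at y" if "y \<in> S" for y
    using assms(2)[OF that] by (rule differentiableI_vector)
  show "smooth_upto k S (\<lambda>y. vector_derivative f (at y))"
    by (rule smooth_upto_cong[OF assms(1) _ assms(3)])
      (auto dest: assms(2) simp: vector_derivative_at)
qed

lemma smooth_upto_SucE:
  assumes "smooth_upto (Suc k) S f"
  obtains f' where "\<And>y. y \<in> S \<Longrightarrow> (f has_vector_derivative f' y) (at y)" "smooth_upto k S f'"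
  using assms that[of "\<lambda>y. vector_derivative f (at y)"]
  by (auto simp: smooth_upto_Suc vector_derivative_works)

lemma smooth_onE:
  assumes "smooth_on S f"
  obtains f' where "\<And>y. y \<in> S \<Longrightarrow> (f has_vector_derivative f' y) (at y)" "smooth_on S f'"
  using assms that[of "\<lambda>y. vector_derivative f (at y)"]
  by (auto simp: smooth_on_iff vector_derivative_works nth_deriv_Suc[symmetric] dest: spec[of _ 0])

lemma smooth_on_continuous_on: "smooth_on S f \<Longrightarrow> continuous_on S f"
  by (metis smooth_onE continuous_at_imp_continuous_on has_vector_derivative_continuous)

lemma smooth_upto_const [simp]: "smooth_upto k S (\<lambda>y. c)"
proof -
  have "nth_deriv n (\<lambda>y::real. c) = (\<lambda>y. if n = 0 then c else 0)" for n
    by (induction n) (auto simp: nth_deriv_Suc')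
  then show ?thesis by (simp add: smooth_upto_def)
qed

lemma smooth_on_const [simp]: "smooth_on S (\<lambda>y. c)"
  by (simp add: smooth_on_def)

lemma smooth_upto_id: "smooth_upto k S (\<lambda>y. y)"
proof (rule smooth_upto_mono)
  show "smooth_upto k UNIV (\<lambda>y::real. y)"
    by (cases k) (auto intro!: smooth_upto_SucI[where f' = "\<lambda>y. 1"] derivative_intros)
qed simp

lemma smooth_on_id: "smooth_on S (\<lambda>y. y)"
  by (simp add: smooth_on_def smooth_upto_id)

lemma smooth_upto_add:
  assumes "open S" "smooth_upto k S f" "smooth_upto k S g"
  shows "smooth_upto k S (\<lambda>y. f y + g y)"
  using assms(2,3)
proof (induction k arbitrary: f g)
  case (Suc k)
  obtain f' where f': "\<And>y. y \<in> S \<Longrightarrow> (f has_vector_derivative f' y) (at y)" "smooth_upto k S f'"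
    using Suc.prems(1) by (elim smooth_upto_SucE) blast
  obtain g' where g': "\<And>y. y \<in> S \<Longrightarrow> (g has_vector_derivative g' y) (at y)" "smooth_upto k S g'"
    using Suc.prems(2) by (elim smooth_upto_SucE) blast
  show ?case
    by (rule smooth_upto_SucI[OF assms(1) _ Suc.IH[OF f'(2) g'(2)]])
      (auto intro!: derivative_intros f' g')
qed simp

text \<open>Products, scalar multiples and linear images all come from this one induction on the
  product rule.\<close>

lemma smooth_upto_bilinear:
  assumes "bounded_bilinear h" "open S" "smooth_upto k S f" "smooth_upto k S g"
  shows "smooth_upto k S (\<lambda>y. h (f y) (g y))"
  using assms(3,4)
proof (induction k arbitrary: f g)
  case (Suc k)
  obtain f' where f': "\<And>y. y \<in> S \<Longrightarrow> (f has_vector_derivative f' y) (at y)" "smooth_upto k S f'"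
    using Suc.prems(1) by (elim smooth_upto_SucE) blast
  obtain g' where g': "\<And>y. y \<in> S \<Longrightarrow> (g has_vector_derivative g' y) (at y)" "smooth_upto k S g'"
    using Suc.prems(2) by (elim smooth_upto_SucE) blast
  show ?case
  proof (rule smooth_upto_SucI[OF assms(2)])
    fix y assume "y \<in> S"
    then show "((\<lambda>y. h (f y) (g y)) has_vector_derivative h (f y) (g' y) + h (f' y) (g y)) (at y)"
      by (intro bounded_bilinear.has_vector_derivative[OF assms(1)] f' g')
  next
    show "smooth_upto k S (\<lambda>y. h (f y) (g' y) + h (f' y) (g y))"
      by (intro smooth_upto_add Suc.IH f' g' assms Suc.prems[THEN smooth_upto_SucD])
  qed
qed simp

lemma smooth_on_bilinear:
  "bounded_bilinear h \<Longrightarrow> open S \<Longrightarrow> smooth_on S f \<Longrightarrow> smooth_on S g \<Longrightarrow> smooth_on S (\<lambda>y. h (f y) (g y))"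
  by (simp add: smooth_on_def smooth_upto_bilinear)

lemma smooth_on_mult:
  fixes f g :: "real \<Rightarrow> 'a::real_normed_algebra"
  shows "open S \<Longrightarrow> smooth_on S f \<Longrightarrow> smooth_on S g \<Longrightarrow> smooth_on S (\<lambda>y. f y * g y)"
  by (rule smooth_on_bilinear[OF bounded_bilinear_mult])

lemma smooth_on_scaleR:
  "open S \<Longrightarrow> smooth_on S f \<Longrightarrow> smooth_on S g \<Longrightarrow> smooth_on S (\<lambda>y. f y *\<^sub>R g y)"
  by (rule smooth_on_bilinear[OF bounded_bilinear_scaleR])

lemma smooth_on_add:
  "open S \<Longrightarrow> smooth_on S f \<Longrightarrow> smooth_on S g \<Longrightarrow> smooth_on S (\<lambda>y. f y + g y)"
  by (simp add: smooth_on_def smooth_upto_add)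

lemma smooth_on_linear:
  assumes "bounded_linear h" "open S" "smooth_on S f"
  shows "smooth_on S (\<lambda>y. h (f y))"
proof -
  \<comment> \<open>A linear map is this bilinear map with its scalar argument frozen at
    \<open>1\<close>.\<close>
  have "bounded_bilinear (\<lambda>(c::real) x. c *\<^sub>R h x)"
    by (rule bounded_bilinear.comp[OF bounded_bilinear_scaleR bounded_linear_ident assms(1)])
  from smooth_on_bilinear[OF this assms(2) _ assms(3), of "\<lambda>y. 1"] show ?thesis by simp
qed

lemma smooth_on_diff:
  assumes "open S" "smooth_on S f" "smooth_on S g" shows "smooth_on S (\<lambda>y. f y - g y)"
  using smooth_on_add[OF assms(1,2) smooth_on_linear[OF bounded_linear_minus[OF bounded_linear_ident] assms(1,3)]]
  by simp

text \<open>By the chain rule the derivative is \<open>f' (g y)\<close> scaled by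
  \<open>g' y\<close>. Its first ingredient is again a composition with the same \<open>g\<close>,
  so the induction varies only \<open>f\<close>.\<close>

lemma smooth_upto_compose:
  assumes "open S" "smooth_upto k T f" "smooth_upto k S g" "\<And>y. y \<in> S \<Longrightarrow> g y \<in> T"
  shows "smooth_upto k S (\<lambda>y. f (g y))"
  using assms(2,3)
proof (induction k arbitrary: f)
  case (Suc k)
  obtain f' where f': "\<And>y. y \<in> T \<Longrightarrow> (f has_vector_derivative f' y) (at y)" "smooth_upto k T f'"
    using Suc.prems(1) by (elim smooth_upto_SucE) blast
  obtain g' where g': "\<And>y. y \<in> S \<Longrightarrow> (g has_vector_derivative g' y) (at y)" "smooth_upto k S g'"
    using Suc.prems(2) by (elim smooth_upto_SucE) blast
  show ?case
  proof (rule smooth_upto_SucI[OF assms(1)])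
    fix y assume "y \<in> S"
    then show "((\<lambda>y. f (g y)) has_vector_derivative g' y *\<^sub>R f' (g y)) (at y)"
      using vector_diff_chain_at[OF g'(1) f'(1), of y] assms(4) by (simp add: o_def)
  next
    show "smooth_upto k S (\<lambda>y. g' y *\<^sub>R f' (g y))"
      by (intro smooth_upto_bilinear[OF bounded_bilinear_scaleR] assms g' Suc.IH f'
          Suc.prems[THEN smooth_upto_SucD])
  qed
qed simp

lemma smooth_on_compose:
  assumes "open S" "smooth_on T f" "smooth_on S g" "\<And>y. y \<in> S \<Longrightarrow> g y \<in> T"
  shows "smooth_on S (\<lambda>y. f (g y))"
  using assms by (auto simp: smooth_on_def intro: smooth_upto_compose)

section \<open>Smoothness of concrete functions and of inverse functions\<close>

lemma smooth_upto_inverse: "smooth_upto k (- {0}) (inverse :: real \<Rightarrow> real)"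
proof (induction k)
  case (Suc k)
  show ?case
  proof (rule smooth_upto_SucI)
    show "(inverse has_vector_derivative - (inverse y * inverse y)) (at y)" if "y \<in> - {0}" for y :: real
      using DERIV_inverse[of y UNIV] that
      by (simp add: has_real_derivative_iff_has_vector_derivative power2_eq_square)
    have "smooth_upto k (- {0}) (\<lambda>y::real. (-1) * (inverse y * inverse y))"
      by (intro smooth_upto_bilinear[OF bounded_bilinear_mult] Suc) auto
    then show "smooth_upto k (- {0}) (\<lambda>y::real. - (inverse y * inverse y))" by simp
  qed auto
qed simp

lemma smooth_on_inverse:
  fixes f :: "real \<Rightarrow> real"
  assumes "open S" "smooth_on S f" "\<And>y. y \<in> S \<Longrightarrow> f y \<noteq> 0"
  shows "smooth_on S (\<lambda>y. inverse (f y))"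
  using smooth_on_compose[OF assms(1) _ assms(2), of "- {0}" inverse] assms(3)
  by (auto simp: smooth_on_def smooth_upto_inverse)

text \<open>Away from \<open>0\<close> the derivative of \<open>root n\<close> is rational in
  \<open>root n\<close> itself, so each order of smoothness yields the next. For odd
  \<open>n\<close> this includes negative arguments.\<close>

lemma smooth_on_root:
  assumes "odd n" "open S" "smooth_on S f" "\<And>y. y \<in> S \<Longrightarrow> f y \<noteq> 0"
  shows "smooth_on S (\<lambda>y. root n (f y))"
proof -
  have "smooth_upto k (- {0}) (root n)" for k
  proof (induction k)
    case (Suc k)
    show ?case
    proof (rule smooth_upto_SucI)
      show "(root n has_vector_derivative inverse (real n * root n y ^ (n - Suc 0))) (at y)"
        if "y \<in> - {0}" for y
        using DERIV_odd_real_root[OF assms(1), of y] that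
        by (simp add: has_real_derivative_iff_has_vector_derivative)
      have 1: "smooth_upto k (- {0}) (\<lambda>y. inverse y :: real)" by (rule smooth_upto_inverse)
      have p: "smooth_upto k (- {0}) (\<lambda>y. root n y ^ j)" for j
        by (induction j) (auto intro: smooth_upto_bilinear[OF bounded_bilinear_mult] Suc)
      show "smooth_upto k (- {0}) (\<lambda>y. inverse (real n * root n y ^ (n - Suc 0)))"
        by (rule smooth_upto_compose[OF _ 1])
          (use assms(1) in \<open>auto intro!: smooth_upto_bilinear[OF bounded_bilinear_mult] p simp: odd_pos\<close>)
    qed auto
  qed simp
  then have "smooth_on (- {0}) (root n)" by (simp add: smooth_on_def)
  from smooth_on_compose[OF assms(2) this assms(3)] assms(4) show ?thesis by auto
qed

text \<open>The image is open by invariance of domain. The derivative of \<open>g\<close> is the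
  reciprocal of \<open>f'\<close> at \<open>g s\<close>, so order \<open>k\<close> for
  \<open>g\<close> gives order \<open>k + 1\<close>.\<close>

lemma smooth_on_inverse_function:
  fixes f g :: "real \<Rightarrow> real"
  assumes "open S" "smooth_on S f"
    and f': "\<And>y. y \<in> S \<Longrightarrow> (f has_vector_derivative f' y) (at y)" "smooth_on S f'"
    and "\<And>y. y \<in> S \<Longrightarrow> f' y \<noteq> 0" and g: "\<And>y. y \<in> S \<Longrightarrow> g (f y) = y"
  shows "open (f ` S)" "\<And>s. s \<in> f ` S \<Longrightarrow> (g has_vector_derivative inverse (f' (g s))) (at s)"
    "smooth_on (f ` S) g"
proof -
  have cont: "continuous_on S f" using assms(2) by (rule smooth_on_continuous_on)
  have "inj_on f S" by (metis g inj_onI)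
  then show op: "open (f ` S)" using invariance_of_domain[OF cont assms(1)] by simp
  show der: "(g has_vector_derivative inverse (f' (g s))) (at s)" if "s \<in> f ` S" for s
  proof -
    from that obtain y where y: "y \<in> S" "s = f y" by auto
    have "(f has_derivative (\<lambda>x. x *\<^sub>R f' y)) (at y)" using f'(1)[OF y(1)] by (simp add: has_vector_derivative_def)
    from has_derivative_inverse_strong[OF assms(1) y(1) cont g this, of "\<lambda>x. x *\<^sub>R inverse (f' y)"]
    show ?thesis using assms(5)[OF y(1)] y g[OF y(1)] by (auto simp: has_vector_derivative_def fun_eq_iff)
  qed
  have "smooth_upto k (f ` S) g" for k
  proof (induction k)
    case (Suc k)
    have 1: "smooth_upto k S (\<lambda>y. inverse (f' y))"
      using smooth_on_inverse[OF assms(1) f'(2)] assms(5) by (auto simp: smooth_on_def)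
    show ?case
      by (rule smooth_upto_SucI[OF op der], assumption, rule smooth_upto_compose[OF op 1 Suc])
        (auto simp: g)
  qed simp
  then show "smooth_on (f ` S) g" by (simp add: smooth_on_def)
qed

text \<open>Each function is the derivative of the other up to sign, so one induction has to carry
  both.\<close>

lemma smooth_on_sin_cos: "smooth_on S (sin :: real \<Rightarrow> real) \<and> smooth_on S (cos :: real \<Rightarrow> real)"
proof -
  have "smooth_upto k UNIV (sin :: real \<Rightarrow> real) \<and> smooth_upto k UNIV (cos :: real \<Rightarrow> real)" for k
  proof (induction k)
    case (Suc k)
    have "smooth_upto k UNIV (\<lambda>x::real. (-1) * sin x)"
      using Suc by (intro smooth_upto_bilinear[OF bounded_bilinear_mult]) auto
    then have "smooth_upto k UNIV (\<lambda>x::real. - sin x)" by simp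
    with Suc show ?case
      by (auto intro!: smooth_upto_SucI[where f = sin and f' = cos]
          smooth_upto_SucI[where f = cos and f' = "\<lambda>x. - sin x"] derivative_eq_intros
          simp flip: has_real_derivative_iff_has_vector_derivative)
  qed simp
  then show ?thesis by (auto simp: smooth_on_def intro: smooth_upto_mono)
qed

lemma smooth_on_exp: "smooth_on UNIV (\<lambda>y::real. exp (c * of_real y) :: complex)"
proof -
  have "smooth_upto k UNIV (\<lambda>y::real. exp (c * of_real y) :: complex)" for k
  proof (induction k)
    case (Suc k)
    show ?case
    proof (rule smooth_upto_SucI)
      show "((\<lambda>y::real. exp (c * of_real y)) has_vector_derivative c * exp (c * of_real y)) (at y)" for y
        by (rule has_vector_derivative_real_field) (auto intro!: derivative_eq_intros)
      show "smooth_upto k UNIV (\<lambda>y::real. c * exp (c * of_real y))"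
        by (intro smooth_upto_bilinear[OF bounded_bilinear_mult] Suc) auto
    qed simp
  qed simp
  then show ?thesis by (simp add: smooth_on_def)
qed

text \<open>The family is closed under differentiation up to linear combinations, which makes the
  flatness of \<open>flat 0\<close> at \<open>0\<close> amenable to induction.\<close>

definition flat :: "nat \<Rightarrow> real \<Rightarrow> real" where
  "flat j x = (if x > 0 then exp (- inverse x) * inverse x ^ j else 0)"

lemma flat_has_vector_derivative:
  "(flat j has_vector_derivative flat (j + 2) x - real j * flat (j + 1) x) (at x)"
proof -
  have "(flat j has_real_derivative flat (j + 2) x - real j * flat (j + 1) x) (at x)"
  proof -
    consider "x > 0" | "x < 0" | "x = 0" by linarith
    then show ?thesis
    proof cases
      case 1
      have "((\<lambda>x. exp (- inverse x) * inverse x ^ j) has_real_derivative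
          flat (j + 2) x - real j * flat (j + 1) x) (at x)"
        using 1 unfolding flat_def
        by (auto intro!: derivative_eq_intros simp: algebra_simps power2_eq_square simp flip: power_Suc)
          (cases j; simp add: field_simps)
      then show ?thesis
        by (rule DERIV_cong_ev[THEN iffD1, rotated -1])
          (use 1 in \<open>auto simp: flat_def intro: eventually_mono[OF eventually_gt_at_top] intro!: eventually_nhds[THEN iffD2] exI[of _ "{0<..}"]\<close>)
    next
      case 2
      have "((\<lambda>x. 0) has_real_derivative flat (j + 2) x - real j * flat (j + 1) x) (at x)"
        using 2 unfolding flat_def by simp
      then show ?thesis
        by (rule DERIV_cong_ev[THEN iffD1, rotated -1])
          (use 2 in \<open>auto simp: flat_def intro!: eventually_nhds[THEN iffD2] exI[of _ "{..<0}"]\<close>)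
    next
      case 3
      \<comment> \<open>The difference quotient of \<open>flat j\<close> at \<open>0\<close> is
        \<open>flat (Suc j)\<close>. With \<open>u = inverse x\<close> its limit from the right is
        the decay of a power against the exponential.\<close>
      have "((\<lambda>u::real. u ^ Suc j / exp u) \<longlongrightarrow> 0) at_top"
        by (rule tendsto_power_div_exp_0)
      then have "((\<lambda>x::real. inverse x ^ Suc j / exp (inverse x)) \<longlongrightarrow> 0) (at_right 0)"
        by (rule filterlim_compose[OF _ filterlim_inverse_at_top_right])
      then have r: "(flat (Suc j) \<longlongrightarrow> 0) (at_right 0)"
        by (rule Lim_transform_eventually)
          (auto simp: flat_def exp_minus divide_inverse eventually_at_right_less
            intro: eventually_mono[OF eventually_at_right_less])
      have l: "(flat (Suc j) \<longlongrightarrow> 0) (at_left 0)"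
        by (rule Lim_transform_eventually[OF tendsto_const])
          (auto simp: flat_def eventually_at_filter)
      have "((\<lambda>h. (flat j (0 + h) - flat j 0) / h) \<longlongrightarrow> 0) (at 0)"
        by (rule Lim_transform_eventually[OF filterlim_split_at[OF l r]])
          (auto simp: flat_def eventually_at_filter divide_inverse)
      then show ?thesis using 3 by (simp add: DERIV_def flat_def)
    qed
  qed
  then show ?thesis by (simp add: has_real_derivative_iff_has_vector_derivative)
qed

lemma smooth_on_flat: "smooth_on UNIV (flat j)"
proof -
  have "smooth_upto k UNIV (flat j)" for k
  proof (induction k arbitrary: j)
    case (Suc k)
    have "smooth_upto k UNIV (\<lambda>x. flat (j + 2) x + (- real j) * flat (j + 1) x)"
      by (intro smooth_upto_add smooth_upto_bilinear[OF bounded_bilinear_mult] Suc) auto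
    then show ?case
      using smooth_upto_SucI[OF open_UNIV flat_has_vector_derivative[of j]] by simp
  qed simp
  then show ?thesis by (simp add: smooth_on_def)
qed

text \<open>The cutoffs are functions of a cosine; this recovers their support within one period as
  an interval.\<close>

lemma cos_less_cos_iff_abs:
  assumes "\<bar>x\<bar> \<le> pi" "0 \<le> d" "d \<le> pi"
  shows "cos d < cos x \<longleftrightarrow> \<bar>x\<bar> < d"
  using cos_mono_less_eq[of d "\<bar>x\<bar>"] assms by (simp add: abs_if split: if_splits)

section \<open>Division by powers of \<open>y - a\<close>, and integrals over a period\<close>

lemma hadamard:
  fixes f :: "real \<Rightarrow> real"
  assumes "smooth_on UNIV f" "f a = 0"
  obtains g where "smooth_on UNIV g" "\<And>y. f y = (y - a) * g y"
    "\<And>k. nth_deriv k g a = nth_deriv (Suc k) f a / real (Suc k)"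
proof -
  \<comment> \<open>\<open>g y\<close> is the integral of \<open>f' (a + t (y - a))\<close> over \<open>0 \<le> t \<le> 1\<close>, differentiated under the integral sign.\<close>
  define F where "F = (\<lambda>k. nth_deriv k f)"
  define G where "G = (\<lambda>k y. integral (cbox 0 1) (\<lambda>t. t ^ k * F (Suc k) (a + t * (y - a))))"
  have F: "(F k has_real_derivative F (Suc k) y) (at y)" for k y
    using assms(1) unfolding F_def smooth_on_iff
    by (simp add: nth_deriv_Suc' has_real_derivative_iff_has_vector_derivative vector_derivative_works)
  have contF: "continuous_on S (F k)" for k S
    using F by (intro continuous_at_imp_continuous_on ballI DERIV_isCont) blast
  have contF': "continuous_on S (\<lambda>x. F k (h x))" if "continuous_on S h" for k S and h :: "'b::topological_space \<Rightarrow> real"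
    using continuous_on_compose[OF that contF] by (simp add: o_def)
  have G: "(G k has_vector_derivative G (Suc k) y) (at y)" for k y
  proof -
    have "(G k has_vector_derivative integral (cbox 0 1) (\<lambda>t. t ^ Suc k * F (Suc (Suc k)) (a + t * (y - a)))) (at y within UNIV)"
      unfolding G_def
    proof (rule leibniz_rule_vector_derivative)
      fix x t :: real
      show "((\<lambda>y. t ^ k * F (Suc k) (a + t * (y - a))) has_vector_derivative
          t ^ Suc k * F (Suc (Suc k)) (a + t * (x - a))) (at x within UNIV)"
        unfolding has_real_derivative_iff_has_vector_derivative[symmetric]
        by (auto intro!: derivative_eq_intros DERIV_chain2[OF F])
    next
      show "(\<lambda>t. t ^ k * F (Suc k) (a + t * (x - a))) integrable_on cbox 0 1" for x
        by (intro integrable_continuous continuous_intros contF')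
    next
      show "continuous_on (UNIV \<times> cbox 0 1) (\<lambda>(x, t). t ^ Suc k * F (Suc (Suc k)) (a + t * (x - a)))"
        unfolding case_prod_unfold by (intro continuous_intros contF')
    qed auto
    then show ?thesis by (simp add: G_def)
  qed
  have nd: "nth_deriv k (G 0) = G k" for k
    by (induction k) (auto simp: nth_deriv_Suc' vector_derivative_at[OF G])
  have "smooth_on UNIV (G 0)"
    using G by (auto simp: smooth_on_iff nd intro: differentiableI_vector)
  moreover have "f y = (y - a) * G 0 y" for y
  proof -
    have "((\<lambda>t. (y - a) * F (Suc 0) (a + t * (y - a))) has_integral f (a + 1 * (y - a)) - f (a + 0 * (y - a))) {0..1}"
    proof (rule fundamental_theorem_of_calculus)
      fix t :: real
      have "((\<lambda>t. F 0 (a + t * (y - a))) has_real_derivative F (Suc 0) (a + t * (y - a)) * (y - a)) (at t within {0..1})"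
        by (rule DERIV_chain2[OF F]) (auto intro!: derivative_eq_intros)
      then show "((\<lambda>t. f (a + t * (y - a))) has_vector_derivative (y - a) * F (Suc 0) (a + t * (y - a))) (at t within {0..1})"
        by (simp add: F_def has_real_derivative_iff_has_vector_derivative mult.commute)
    qed simp
    then have "integral {0..1} (\<lambda>t. (y - a) * F (Suc 0) (a + t * (y - a))) = f y"
      using assms(2) by (simp add: has_integral_iff)
    then show ?thesis by (simp add: G_def)
  qed
  moreover have "nth_deriv k (G 0) a = nth_deriv (Suc k) f a / real (Suc k)" for k
  proof -
    \<comment> \<open>At \<open>y = a\<close> the integrand of \<open>G k\<close> is a constant
      times \<open>t ^ k\<close>; this is the origin of the factor
      \<open>1 / real (Suc k)\<close>.\<close>
    have "((\<lambda>t. t ^ k) has_integral 1 ^ Suc k / real (Suc k) - 0 ^ Suc k / real (Suc k)) {0..1::real}"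
      by (rule fundamental_theorem_of_calculus)
        (auto intro!: derivative_eq_intros simp del: power_Suc of_nat_Suc
          simp flip: has_real_derivative_iff_has_vector_derivative)
    then have "((\<lambda>t. t ^ k) has_integral 1 / real (Suc k)) {0..1::real}"
      by simp
    then have "integral {0..1} (\<lambda>t::real. t ^ k) = 1 / real (Suc k)" by (rule integral_unique)
    then show ?thesis unfolding nd by (simp add: G_def F_def)
  qed
  ultimately show ?thesis by (rule that)
qed

text \<open>Dividing by \<open>y - a\<close> shifts the derivatives at \<open>a\<close> down by one,
  up to nonzero factors, so the quotient satisfies the hypotheses with \<open>p\<close> lowered by
  one.\<close>

lemma hadamard_power:
  fixes f :: "real \<Rightarrow> real"
  assumes "smooth_on UNIV f" "\<And>k. k < p \<Longrightarrow> nth_deriv k f a = 0" "nth_deriv p f a \<noteq> 0"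
  obtains h where "smooth_on UNIV h" "\<And>y. f y = (y - a) ^ p * h y" "h a \<noteq> 0"
  using assms
proof (induction p arbitrary: f thesis)
  case 0
  then show ?case by simp
next
  case (Suc p)
  have "f a = 0" using Suc.prems(3)[of 0] by simp
  then obtain g where g: "smooth_on UNIV g" "\<And>y. f y = (y - a) * g y"
    "\<And>k. nth_deriv k g a = nth_deriv (Suc k) f a / real (Suc k)"
    using hadamard[OF Suc.prems(2)] by metis
  obtain h where "smooth_on UNIV h" "\<And>y. g y = (y - a) ^ p * h y" "h a \<noteq> 0"
    by (rule Suc.IH[OF _ g(1)]) (use Suc.prems g(3) in auto)
  then show ?case using Suc.prems(1)[of h] g(2) by (simp add: mult.assoc)
qed

lemma integral_periodic:
  fixes f :: "real \<Rightarrow> 'a::euclidean_space"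
  assumes cont: "continuous_on UNIV f" and per: "\<And>y. f (y + T) = f y" and "0 \<le> T"
  shows "integral {c..c + T} f = integral {0..T} f"
proof -
  have f: "f integrable_on {a..b}" for a b
    by (intro integrable_continuous_interval continuous_on_subset[OF cont]) simp
  \<comment> \<open>A base point to the left of both \<open>0\<close> and \<open>c\<close> reduces
    the claim to splitting one interval in two ways, without a case distinction on the sign of
    \<open>c\<close>.\<close>
  define A where "A = min 0 c"
  have A: "A \<le> 0" "A \<le> c" by (auto simp: A_def)
  have sh: "integral {A..x} f = integral {A + T..x + T} f" for x
    using integral_shift[of A T x f] continuous_on_subset[OF cont] by (simp add: o_def per)
  have "integral {A..x + T} f = integral {A..A + T} f + integral {A + T..x + T} f" if "A \<le> x" for x
    using Henstock_Kurzweil_Integration.integral_combine[of A "A + T" "x + T" f] f that assms(3) by simp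
  moreover have "integral {A..x + T} f = integral {A..x} f + integral {x..x + T} f" if "A \<le> x" for x
    using Henstock_Kurzweil_Integration.integral_combine[of A x "x + T" f] f that assms(3) by simp
  ultimately have "integral {x..x + T} f = integral {A..A + T} f" if "A \<le> x" for x
    using that sh by (metis add.commute add_left_cancel)
  from this[of c] this[of 0] A show ?thesis by simp
qed

section \<open>Coordinates at points of odd order\<close>

lemma periodic_int:
  assumes "\<And>y::real. f (y + 2 * pi) = f y"
  shows "f (y + 2 * pi * of_int k) = f y"
proof -
  have "f (y + 2 * pi * of_nat n) = f y" for n y
  proof (induction n)
    case (Suc n)
    have "f (y + 2 * pi * of_nat (Suc n)) = f ((y + 2 * pi * of_nat n) + 2 * pi)"
      by (simp add: algebra_simps)
    then show ?case using Suc assms by simp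
  qed simp
  from this[of y "nat k"] this[of "y + 2 * pi * of_int k" "nat (- k)"]
  show ?thesis by (cases "k \<ge> 0") auto
qed

lemma shift_into_period:
  fixes y c :: real
  obtains k :: int where "\<bar>y - 2 * pi * of_int k - c\<bar> \<le> pi"
proof -
  define t where "t = (y - c + pi) / (2 * pi)"
  have t: "2 * pi * t = y - c + pi" by (simp add: t_def)
  have "of_int \<lfloor>t\<rfloor> \<le> t" "t \<le> of_int \<lfloor>t\<rfloor> + 1" by linarith+
  then have "2 * pi * of_int \<lfloor>t\<rfloor> \<le> 2 * pi * t" "2 * pi * t \<le> 2 * pi * (of_int \<lfloor>t\<rfloor> + 1)"
    by (simp_all add: mult_left_mono)
  then have "\<bar>y - 2 * pi * of_int \<lfloor>t\<rfloor> - c\<bar> \<le> pi" unfolding t by (simp add: algebra_simps abs_le_iff)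
  then show ?thesis by (rule that)
qed

text \<open>A window centred at \<open>c\<close> keeps a coordinate interval in one piece even if it
  straddles an end of the fundamental domain. Translation by multiples of the period carries
  smoothness to all other points.\<close>

lemma smooth_circleI_local:
  assumes per: "\<And>y. f (y + 2 * pi) = f y"
    and loc: "\<And>y. \<bar>y - c\<bar> \<le> pi \<Longrightarrow> \<exists>T. open T \<and> y \<in> T \<and> smooth_on T f"
  shows "smooth_circle f"
  unfolding smooth_circle_def
proof (intro conjI allI)
  show "nth_deriv n f differentiable at y" for n y
  proof -
    obtain k :: int where "\<bar>y - 2 * pi * of_int k - c\<bar> \<le> pi" by (rule shift_into_period)
    from loc[OF this] obtain T where T: "open T" "y - 2 * pi * of_int k \<in> T" "smooth_on T f" by auto
    define S where "S = (\<lambda>y. y - 2 * pi * of_int k) -` T"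
    have S: "open S" unfolding S_def
      by (intro open_vimage T continuous_intros)
    have "smooth_on S (\<lambda>y. f (y - 2 * pi * of_int k))"
      by (rule smooth_on_compose[OF S T(3)])
        (auto simp: S_def intro!: smooth_on_diff smooth_on_id S[unfolded S_def])
    moreover have "f (y - 2 * pi * of_int k) = f y" for y
      using periodic_int[of f "y - 2 * pi * of_int k" k, OF per] by simp
    ultimately show ?thesis using T(2) by (simp add: smooth_on_iff S_def)
  qed
qed (rule per)

text \<open>Writing \<open>f y = (y - a) ^ p * h y\<close> with \<open>h a \<noteq> 0\<close> gives
  \<open>root p (f y) = (y - a) * root p (h y)\<close>: the root is taken only away from
  \<open>0\<close>, and the derivative at \<open>a\<close> is \<open>root p (h a)\<close>. The sign
  \<open>\<kappa>\<close> treats increasing and decreasing coordinates together;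
  \<open>e \<le> pi\<close> keeps the interval within one period.\<close>

lemma root_chart:
  fixes f :: "real \<Rightarrow> real"
  assumes "smooth_on UNIV f" "odd p" "\<And>k. k < p \<Longrightarrow> nth_deriv k f a = 0" "nth_deriv p f a \<noteq> 0"
  obtains e u' \<kappa> where "0 < e" "e \<le> pi" "\<bar>\<kappa>\<bar> = 1" "smooth_on {a - e<..<a + e} (\<lambda>y. root p (f y))"
    "\<And>y. y \<in> {a - e<..<a + e} \<Longrightarrow> ((\<lambda>y. root p (f y)) has_vector_derivative u' y) (at y)"
    "\<And>y. y \<in> {a - e<..<a + e} \<Longrightarrow> 0 < \<kappa> * u' y" "smooth_on {a - e<..<a + e} u'"
proof -
  obtain h where h: "smooth_on UNIV h" "\<And>y. f y = (y - a) ^ p * h y" "h a \<noteq> 0"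
    using hadamard_power[OF assms(1,3,4)] by metis
  have "\<forall>\<^sub>F y in nhds a. h y \<noteq> 0"
    using smooth_on_continuous_on[OF h(1)] h(3)
    by (intro tendsto_imp_eventually_ne) (auto simp: continuous_on_eq_continuous_at continuous_at tendsto_at_iff_tendsto_nhds)
  then obtain B where B: "open B" "a \<in> B" "\<And>y. y \<in> B \<Longrightarrow> h y \<noteq> 0"
    by (auto simp: eventually_nhds)
  define w where "w = (\<lambda>y. root p (h y))"
  have u: "root p (f y) = (y - a) * w y" for y
    using assms(2) by (simp add: h(2) w_def real_root_mult odd_real_root_power_cancel)
  have w: "smooth_on B w" unfolding w_def
    by (intro smooth_on_root assms B smooth_on_mono[OF h(1)]) auto
  have su: "smooth_on B (\<lambda>y. root p (f y))"
    unfolding u by (intro smooth_on_mult smooth_on_diff smooth_on_id B w smooth_on_const)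
  obtain u' where u': "\<And>y. y \<in> B \<Longrightarrow> ((\<lambda>y. root p (f y)) has_vector_derivative u' y) (at y)" "smooth_on B u'"
    using su by (rule smooth_onE) blast
  obtain w' where w': "\<And>y. y \<in> B \<Longrightarrow> (w has_vector_derivative w' y) (at y)"
    using w by (rule smooth_onE) blast
  have "((\<lambda>y. (y - a) * w y) has_vector_derivative (a - a) * w' a + 1 * w a) (at a)"
    by (intro bounded_bilinear.has_vector_derivative[OF bounded_bilinear_mult] w' B)
      (auto intro!: derivative_eq_intros)
  with u'(1)[OF B(2)] have ua: "u' a = w a"
    unfolding u by (simp add: vector_derivative_unique_at)
  define \<kappa> where "\<kappa> = sgn (u' a)"
  have "u' a \<noteq> 0" using h(3) assms(2) by (simp add: ua w_def odd_pos)
  then have k: "\<bar>\<kappa>\<bar> = 1" "0 < \<kappa> * u' a" by (auto simp: \<kappa>_def sgn_real_def)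
  have "isCont u' a"
    using smooth_on_continuous_on[OF u'(2)] B by (simp add: continuous_on_eq_continuous_at)
  then have "((\<lambda>y. \<kappa> * u' y) \<longlongrightarrow> \<kappa> * u' a) (nhds a)"
    by (intro tendsto_intros) (simp add: continuous_at isCont_def tendsto_at_iff_tendsto_nhds)
  then have "\<forall>\<^sub>F y in nhds a. 0 < \<kappa> * u' y"
    using k(2) by (rule order_tendstoD)
  moreover have "\<forall>\<^sub>F y in nhds a. y \<in> B"
    using B by (auto simp: eventually_nhds)
  ultimately have "\<forall>\<^sub>F y in nhds a. y \<in> B \<and> 0 < \<kappa> * u' y" by (simp add: eventually_conj)
  then obtain d where d: "d > 0" "\<And>y. dist y a < d \<Longrightarrow> y \<in> B \<and> 0 < \<kappa> * u' y"
    by (auto simp: eventually_nhds_metric)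
  define e where "e = min d pi"
  have sub: "y \<in> B \<and> 0 < \<kappa> * u' y" if "y \<in> {a - e<..<a + e}" for y
    using that d(2)[of y] by (auto simp: e_def dist_real_def)
  show ?thesis
    by (rule that[of e \<kappa> u'])
      (use d k sub u' in \<open>auto simp: e_def intro: smooth_on_mono[OF su] smooth_on_mono[OF u'(2)]\<close>)
qed


text \<open>
  Near a solution \<open>y0\<close> of \<open>R y = c\<close> of odd order \<open>p\<close> the function \<open>s = root p (R y - c)\<close> is a smooth
  coordinate vanishing at \<open>y0\<close>, in which \<open>R = c + s ^ p\<close>.  Here \<open>\<rho>\<close> is a cutoff supported in the domain
  of this coordinate, and \<open>X f\<close> is the density \<open>\<rho> f dy\<close> written as a multiple of \<open>ds\<close>, extended by \<open>0\<close>
  to all \<open>s\<close>.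
\<close>

locale level_chart =
  fixes R :: "real \<Rightarrow> real" and c :: real and p :: nat and y0 :: real and Z :: "real set"
    and \<rho> :: "real \<Rightarrow> real" and X :: "(real \<Rightarrow> complex) \<Rightarrow> real \<Rightarrow> complex"
  assumes odd_p: "odd p"
    and cutoff_nonzero: "\<rho> y0 \<noteq> 0"
    and cutoff_zero: "z \<in> Z \<Longrightarrow> \<rho> z = 0"
    and smooth_pullback: "smooth_on UNIV (K :: real \<Rightarrow> complex) \<Longrightarrow>
      smooth_circle (\<lambda>y. \<rho> y *\<^sub>R K (root p (R y - c)))"
    and smooth_transfer: "smooth_circle f \<Longrightarrow> smooth_on UNIV (X f)"
    and integral_transfer: "smooth_circle f \<Longrightarrow> smooth_on UNIV K \<Longrightarrow>
      integral {0..2 * pi} (\<lambda>y. cnj (f y) * (\<rho> y *\<^sub>R K (root p (R y - c)))) =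
      integral UNIV (\<lambda>s. cnj (X f s) * K s)"
    and transfer_0: "f y0 \<noteq> 0 \<Longrightarrow> X f 0 \<noteq> 0"
    and transfer_add: "X (\<lambda>y. f y + g y) s = X f s + X g s"
    and transfer_mult: "X (\<lambda>y. w (R y) * f y) s = w (c + s ^ p) * X f s"

text \<open>Extension by zero is smooth, both on the circle and on the \<open>s\<close> line,
  because the cutoff already vanishes at distance \<open>\<delta> < e\<close> from
  \<open>y0\<close>, before the coordinate interval ends. The integral identity is then the
  substitution \<open>s = u y\<close>.\<close>

lemma level_chart_exists:
  assumes R: "smooth_circle R" and p: "odd p"
    and ord: "R y0 = c" "\<And>k. 1 \<le> k \<Longrightarrow> k < p \<Longrightarrow> nth_deriv k R y0 = 0" "nth_deriv p R y0 \<noteq> 0"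
    and Z: "finite Z" "Z \<subseteq> {0..<2 * pi}" "y0 \<in> {0..<2 * pi}" "y0 \<notin> Z"
  obtains \<rho> X where "level_chart R c p y0 Z \<rho> X"
proof -
  have Rper: "R (y + 2 * pi) = R y" and Rsm: "smooth_on UNIV R" for y
    using R by (auto simp: smooth_circle_iff)
  define u where "u = (\<lambda>y. root p (R y - c))"
  have uper: "u (y + 2 * pi) = u y" for y by (simp add: u_def Rper)
  have p0: "p > 0" using p by (simp add: odd_pos)
  have nd: "nth_deriv k (\<lambda>y. R y - c) = nth_deriv k R" if k1: "k \<ge> 1" for k
  proof -
    obtain j where j: "k = Suc j" using k1 Suc_le_D[of 0 k] by auto
    have "vector_derivative (\<lambda>y. R y - c) (at y) = vector_derivative R (at y)" for y
      using Rsm by (intro vector_derivative_at)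
        (auto intro!: derivative_eq_intros simp: smooth_on_iff vector_derivative_works dest: spec[of _ 0])
    then show ?thesis by (simp add: j nth_deriv_Suc)
  qed
  obtain e u' \<kappa> where e: "0 < e" "e \<le> pi" "\<bar>\<kappa>\<bar> = 1"
    and usm: "smooth_on {y0 - e<..<y0 + e} u"
    and u': "\<And>y. y \<in> {y0 - e<..<y0 + e} \<Longrightarrow> (u has_vector_derivative u' y) (at y)"
    and pos: "\<And>y. y \<in> {y0 - e<..<y0 + e} \<Longrightarrow> 0 < \<kappa> * u' y"
    and u'sm: "smooth_on {y0 - e<..<y0 + e} u'"
  proof (rule root_chart[of "\<lambda>y. R y - c" p y0])
    show "nth_deriv k (\<lambda>y. R y - c) y0 = 0" if "k < p" for k
      using that ord nd[of k] by (cases "k = 0") auto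
    show "nth_deriv p (\<lambda>y. R y - c) y0 \<noteq> 0" using ord(3) nd[of p] p0 by simp
  qed (use p in \<open>auto simp: u_def intro: smooth_on_diff Rsm\<close>)
  define S where "S = {y0 - e<..<y0 + e}"
  have S: "open S" by (simp add: S_def)
  note usm = usm[folded S_def] and u' = u'[folded S_def] and pos = pos[folded S_def]
    and u'sm = u'sm[folded S_def]
  have mono: "\<kappa> * u x < \<kappa> * u y" if "x \<in> S" "y \<in> S" "x < y" for x y
  proof (rule DERIV_pos_imp_increasing[OF \<open>x < y\<close>])
    fix z assume "x \<le> z" "z \<le> y"
    then have "z \<in> S" using that by (auto simp: S_def)
    then have "((\<lambda>y. \<kappa> * u y) has_real_derivative \<kappa> * u' z) (at z)"
      using u' by (auto intro!: derivative_eq_intros simp: has_real_derivative_iff_has_vector_derivative)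
    then show "\<exists>d. ((\<lambda>y. \<kappa> * u y) has_real_derivative d) (at z) \<and> 0 < d"
      using pos \<open>z \<in> S\<close> by blast
  qed
  have inj: "inj_on u S"
    by (rule linorder_inj_onI) (use mono in \<open>force simp: S_def\<close>)+
  define \<xi> where "\<xi> = inv_into S u"
  have \<xi>: "\<xi> (u y) = y" if "y \<in> S" for y using inj that by (simp add: \<xi>_def)
  have u'0: "u' y \<noteq> 0" if "y \<in> S" for y using pos[OF that] by auto
  note inv = smooth_on_inverse_function[OF S usm u' u'sm u'0 \<xi>]
  have "\<forall>\<^sub>F d in at_right 0. d < e"
    using eventually_at_right_real[OF e(1)] by (rule eventually_mono) simp
  \<comment> \<open>As \<open>d\<close> tends to \<open>0\<close>, \<open>cos d\<close> tends to
    \<open>1\<close>, while \<open>cos (z - y0)\<close> is below \<open>1\<close> because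
    \<open>z\<close> and \<open>y0\<close> are distinct points of the half-open period. Finiteness
    of \<open>Z\<close> gives one \<open>\<delta>\<close> for all \<open>z\<close>.\<close>
  moreover have "\<forall>\<^sub>F d in at_right 0. cos d > cos (z - y0)" if "z \<in> Z" for z
  proof -
    have "z \<in> {0..<2 * pi}" using that Z by blast
    then have "z \<noteq> y0" "\<bar>z - y0\<bar> < 2 * pi" using that Z by auto
    then have "cos (z - y0) \<noteq> 1"
      using cos_one_2pi_int[of "z - y0"] by (auto simp: abs_mult simp flip: of_int_abs)
    then have "cos (z - y0) < cos 0" using cos_le_one[of "z - y0"] by (simp add: less_le)
    moreover have "(cos \<longlongrightarrow> cos (0::real)) (at_right 0)" by (intro tendsto_intros)
    ultimately show ?thesis by (intro order_tendstoD)
  qed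
  then have "\<forall>\<^sub>F d in at_right 0. \<forall>z\<in>Z. cos d > cos (z - y0)"
    using Z(1) by (simp add: eventually_ball_finite)
  ultimately have "\<forall>\<^sub>F d in at_right 0. d < e \<and> (\<forall>z\<in>Z. cos d > cos (z - y0)) \<and> 0 < d"
    by (intro eventually_conj eventually_at_right_less)
  then obtain \<delta> where \<delta>: "0 < \<delta>" "\<delta> < e" "\<And>z. z \<in> Z \<Longrightarrow> cos \<delta> > cos (z - y0)"
    using eventually_happens' trivial_limit_at_right_real by blast
  \<comment> \<open>Positive exactly where \<open>cos (y - y0) > cos \<delta>\<close>, that is
    within distance \<open>\<delta>\<close> of \<open>y0\<close> modulo the period.\<close>
  define \<rho> where "\<rho> = (\<lambda>y. flat 0 (cos (y - y0) - cos \<delta>))"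
  have \<rho>per: "\<rho> (y + 2 * pi) = \<rho> y" for y
    using cos_periodic[of "y - y0"] by (simp add: \<rho>_def algebra_simps)
  have \<rho>0: "\<rho> y = 0 \<longleftrightarrow> cos (y - y0) \<le> cos \<delta>" for y by (auto simp: \<rho>_def flat_def)
  have \<rho>sm: "smooth_on UNIV \<rho>"
    unfolding \<rho>_def
    by (intro smooth_on_compose[OF open_UNIV smooth_on_flat] smooth_on_diff
        smooth_on_compose[OF open_UNIV conjunct2[OF smooth_on_sin_cos[of UNIV]]] smooth_on_id) auto
  have \<rho>supp: "\<bar>y - y0\<bar> < \<delta>" if "\<bar>y - y0\<bar> \<le> pi" "\<rho> y \<noteq> 0" for y
    using cos_less_cos_iff_abs[of "y - y0" \<delta>] that \<delta> e \<rho>0[of y] by auto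
  \<comment> \<open>Every \<open>X f\<close> below vanishes off \<open>C\<close>, which is compact
    inside the open image of \<open>S\<close>. That image and \<open>- C\<close> are therefore open
    sets covering the line, and smoothness can be checked on each.\<close>
  define C where "C = u ` {y0 - \<delta>..y0 + \<delta>}"
  have CS: "{y0 - \<delta>..y0 + \<delta>} \<subseteq> S" using \<delta> by (auto simp: S_def)
  have Scont: "continuous_on S u" by (rule smooth_on_continuous_on[OF usm])
  have "compact C" unfolding C_def
    by (intro compact_continuous_image continuous_on_subset[OF Scont] CS) simp
  then have C: "open (- C)" "C \<subseteq> u ` S" using CS by (auto simp: C_def compact_imp_closed)
  \<comment> \<open>As \<open>\<kappa>\<close> is the sign of \<open>u'\<close>, the factor
    \<open>\<kappa> * inverse (u' (\<xi> s))\<close> is the absolute value of the derivative of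
    \<open>\<xi>\<close>, the Jacobian that turns \<open>dy\<close> into \<open>ds\<close>.\<close>
  define X where "X = (\<lambda>(f :: real \<Rightarrow> complex) s. if s \<in> u ` S then (\<rho> (\<xi> s) * (\<kappa> * inverse (u' (\<xi> s)))) *\<^sub>R f (\<xi> s) else 0)"
  have XC: "X f s = 0" if "s \<notin> C" for f s
  proof (cases "s \<in> u ` S")
    case True
    then obtain y where y: "y \<in> S" "s = u y" by auto
    with that have "\<rho> y = 0" using \<rho>supp[of y] e(2) by (fastforce simp: C_def S_def abs_le_iff)
    then show ?thesis using y by (simp add: X_def \<xi>)
  qed (simp add: X_def)
  have Xsm: "smooth_on UNIV (X f)" if f: "smooth_circle f" for f
  proof -
    have fs: "smooth_on UNIV f" using f by (simp add: smooth_circle_iff)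
    have sm: "smooth_on (u ` S) (\<lambda>s. (\<rho> (\<xi> s) * (\<kappa> * inverse (u' (\<xi> s)))) *\<^sub>R f (\<xi> s))"
    proof (intro smooth_on_scaleR smooth_on_mult inv smooth_on_const)
      show "smooth_on (u ` S) (\<lambda>s. \<rho> (\<xi> s))" "smooth_on (u ` S) (\<lambda>s. f (\<xi> s))"
        by (rule smooth_on_compose[OF inv(1) \<rho>sm inv(3)] smooth_on_compose[OF inv(1) fs inv(3)]; simp)+
      show "smooth_on (u ` S) (\<lambda>s. inverse (u' (\<xi> s)))"
        by (rule smooth_on_inverse[OF inv(1) smooth_on_compose[OF inv(1) u'sm inv(3)]])
          (auto simp: \<xi> u'0)
    qed
    have eq: "(\<rho> (\<xi> s) * (\<kappa> * inverse (u' (\<xi> s)))) *\<^sub>R f (\<xi> s) = X f s" if s: "s \<in> u ` S" for s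
      unfolding X_def if_P[OF s] ..
    have "smooth_on (u ` S) (X f)"
      by (rule smooth_on_cong[OF inv(1) eq sm])
    moreover have "smooth_on (- C) (X f)"
      by (rule smooth_on_cong[OF C(1) _ smooth_on_const]) (simp add: XC)
    ultimately have "smooth_on (u ` S \<union> - C) (X f)" by (rule smooth_on_Un)
    moreover have "u ` S \<union> - C = UNIV" using C(2) by auto
    ultimately show ?thesis by simp
  qed
  have pull: "smooth_circle (\<lambda>y. \<rho> y *\<^sub>R K (u y))" if K: "smooth_on UNIV K" for K :: "real \<Rightarrow> complex"
  proof (rule smooth_circleI_local[where c = y0])
    fix y assume y: "\<bar>y - y0\<bar> \<le> pi"
    show "\<exists>T. open T \<and> y \<in> T \<and> smooth_on T (\<lambda>y. \<rho> y *\<^sub>R K (u y))"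
    proof (cases "y \<in> S")
      case True
      then show ?thesis
        by (intro exI[of _ S] conjI S smooth_on_scaleR smooth_on_mono[OF \<rho>sm]
            smooth_on_compose[OF S K usm]) auto
    next
      case False
      \<comment> \<open>Off the coordinate interval the distance from \<open>y0\<close> is at least
        \<open>e > \<delta>\<close>, so the cutoff vanishes on a whole neighbourhood and smoothness
        of \<open>u\<close> is not at issue.\<close>
      define T where "T = {y. cos (y - y0) < cos \<delta>}"
      have T: "open T" unfolding T_def by (intro open_Collect_less continuous_intros)
      have "\<bar>y - y0\<bar> \<ge> e" using False by (auto simp: S_def)
      then have "y \<in> T" using cos_monotone_0_pi[of \<delta> "\<bar>y - y0\<bar>"] y \<delta> by (simp add: T_def)
      moreover have "smooth_on T (\<lambda>y. \<rho> y *\<^sub>R K (u y))"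
        by (rule smooth_on_cong[OF T _ smooth_on_const[where c = 0]]) (simp add: T_def \<rho>0)
      ultimately show ?thesis using T by blast
    qed
  qed (simp add: \<rho>per uper)
  have int: "integral {0..2 * pi} (\<lambda>y. cnj (f y) * (\<rho> y *\<^sub>R K (u y))) = integral UNIV (\<lambda>s. cnj (X f s) * K s)"
    if f: "smooth_circle f" and K: "smooth_on UNIV K" for f K
  proof -
    define G where "G = (\<lambda>y. cnj (f y) * (\<rho> y *\<^sub>R K (u y)))"
    define F where "F = (\<lambda>s. cnj (X f s) * K s)"
    have Gcont: "continuous_on UNIV G" unfolding G_def
      using f pull[OF K] by (intro continuous_intros smooth_on_continuous_on) (auto simp: smooth_circle_iff)
    have "continuous_on UNIV F" unfolding F_def
      by (rule continuous_on_mult[OF continuous_on_cnj])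
        (use Xsm[OF f] K in \<open>auto intro: smooth_on_continuous_on\<close>)
    then have Fcont: "continuous_on A F" for A by (rule continuous_on_subset) simp
    have Gper: "G (y + 2 * pi) = G y" for y
      using f by (simp add: G_def smooth_circle_iff \<rho>per uper)
    define a where "a = y0 - \<delta>"
    define b where "b = y0 + \<delta>"
    have ab: "a \<le> b" "{a..b} \<subseteq> S" "C = u ` {a..b}" using \<delta> CS by (auto simp: a_def b_def C_def)
    then have abS: "a \<in> S" "b \<in> S" by auto
    \<comment> \<open>Recentring the period at \<open>y0\<close> keeps the support of
      \<open>G\<close> in one piece.\<close>
    have "integral {0..2 * pi} G = integral {y0 - pi..y0 + pi} G"
      using integral_periodic[OF Gcont Gper, of "y0 - pi"] by (simp add: add.commute)
    also have "\<dots> = integral {y0 - pi..y0 + pi} (\<lambda>y. if y \<in> {a..b} then G y else 0)"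
    proof (rule integral_cong)
      fix y assume "y \<in> {y0 - pi..y0 + pi}"
      then have "\<bar>y - y0\<bar> \<le> pi" by (auto simp: abs_le_iff)
      then show "G y = (if y \<in> {a..b} then G y else 0)"
        using \<rho>supp[of y] by (auto simp: G_def a_def b_def)
    qed
    also have "\<dots> = integral ({y0 - pi..y0 + pi} \<inter> {a..b}) G" by (simp only: Henstock_Kurzweil_Integration.integral_restrict_Int Int_commute)
    also have "{y0 - pi..y0 + pi} \<inter> {a..b} = {a..b}" using \<delta> e by (auto simp: a_def b_def)
    finally have 1: "integral {0..2 * pi} G = integral {a..b} G" .
    have mon: "\<kappa> * u x \<le> \<kappa> * u y" if "x \<in> S" "y \<in> S" "x \<le> y" for x y
      using mono[OF that(1,2)] that(3) by (cases "x = y") auto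
    have Cab: "C \<subseteq> {min (u a) (u b)..max (u a) (u b)}"
    proof -
      have "u y \<in> {min (u a) (u b)..max (u a) (u b)}" if "y \<in> {a..b}" for y
      proof -
        have "a \<in> S" "b \<in> S" "y \<in> S" using that ab by auto
        then show ?thesis
          using mon[of a y] mon[of y b] that e(3) by (auto simp: abs_if split: if_splits)
      qed
      then show ?thesis using ab(3) by auto
    qed
    \<comment> \<open>The difference of the two integrals is an oriented integral: the interval
      whose ends are in the wrong order is empty and contributes \<open>0\<close>. A decreasing
      \<open>u\<close> is thereby included.\<close>
    have "((\<lambda>y. u' y *\<^sub>R F (u y)) has_integral (integral {u a..u b} F - integral {u b..u a} F)) {a..b}"
    proof (rule has_integral_substitution_general[of "{}" a b u "min (u a) (u b)" "max (u a) (u b)"])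
      show "u ` {a..b} \<subseteq> {min (u a) (u b)..max (u a) (u b)}" using Cab ab(3) by simp
      show "continuous_on {a..b} u" by (rule continuous_on_subset[OF Scont ab(2)])
      show "(u has_field_derivative u' y) (at y within {a..b})" if "y \<in> {a..b} - {}" for y
        unfolding has_real_derivative_iff_has_vector_derivative
        by (rule has_vector_derivative_at_within[OF u']) (use that ab(2) in auto)
    qed (use ab Fcont in auto)
    moreover have "integral {a..b} (\<lambda>y. u' y *\<^sub>R F (u y)) = integral {a..b} (\<lambda>y. \<kappa> *\<^sub>R G y)"
    proof (rule integral_cong)
      fix y assume "y \<in> {a..b}"
      then have "y \<in> S" using ab by auto
      then show "u' y *\<^sub>R F (u y) = \<kappa> *\<^sub>R G y"
        using u'0[of y] by (simp add: F_def G_def X_def \<xi> scaleR_conv_of_real field_simps)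
    qed
    ultimately have 2: "\<kappa> *\<^sub>R integral {a..b} G = integral {u a..u b} F - integral {u b..u a} F"
      by (simp add: has_integral_iff)
    have "integral UNIV F = integral UNIV (\<lambda>s. if s \<in> {min (u a) (u b)..max (u a) (u b)} then F s else 0)"
    proof (rule integral_cong)
      fix s
      have "F s = 0" if "s \<notin> {min (u a) (u b)..max (u a) (u b)}"
      proof -
        have "s \<notin> C" using Cab that by blast
        then show ?thesis by (simp add: F_def XC)
      qed
      then show "F s = (if s \<in> {min (u a) (u b)..max (u a) (u b)} then F s else 0)" by simp
    qed
    also have "\<dots> = integral {min (u a) (u b)..max (u a) (u b)} F" by (simp only: Henstock_Kurzweil_Integration.integral_restrict_UNIV)
    finally have 3: "integral UNIV F = integral {min (u a) (u b)..max (u a) (u b)} F" .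
    have "integral UNIV F = integral {a..b} G"
    proof (cases "\<kappa> = 1")
      case True
      with mon[of a b] ab abS have "u a \<le> u b" by auto
      then show ?thesis using 2 3 True by (cases "u a = u b") (auto simp: min_def max_def)
    next
      case False
      with e(3) have k: "\<kappa> = - 1" by auto
      with mon[of a b] ab abS have "u b \<le> u a" by auto
      then show ?thesis using 2 3 k by (cases "u a = u b") (auto simp: min_def max_def)
    qed
    then show ?thesis using 1 by (simp add: F_def G_def)
  qed
  have y0: "y0 \<in> S" "u y0 = 0" "\<rho> y0 \<noteq> 0"
    using e ord(1) \<delta> cos_monotone_0_pi[of 0 \<delta>] by (auto simp: S_def u_def \<rho>0)
  have R\<xi>: "R (\<xi> s) = c + s ^ p" if "s \<in> u ` S" for s
  proof -
    from that obtain y where y: "y \<in> S" "s = u y" by auto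
    then show ?thesis using p by (simp add: \<xi>) (simp add: u_def odd_real_root_pow)
  qed
  show ?thesis
  proof (rule that[of \<rho> X], unfold_locales)
    show "X f 0 \<noteq> 0" if "f y0 \<noteq> 0" for f
    proof -
      have "0 \<in> u ` S" "\<xi> 0 = y0" using y0 \<xi>[of y0] by (auto intro: image_eqI[of _ _ y0])
      then show ?thesis using that y0 u'0[of y0] e(3) by (auto simp: X_def)
    qed
    show "X (\<lambda>y. f y + g y) s = X f s + X g s" for f g s
      by (simp add: X_def scaleR_add_right)
    show "X (\<lambda>y. w (R y) * f y) s = w (c + s ^ p) * X f s" for w f s
      by (simp add: X_def R\<xi>)
  qed (use p y0 \<rho>0 \<delta>(3) pull Xsm int in \<open>auto simp: u_def less_imp_le\<close>)
qed

section \<open>Modes of test functions\<close>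

lemma sets_torus_borel: "({0..<2 * pi} \<times> {0..<2 * pi} :: (real \<times> real) set) \<in> sets borel"
  by (simp add: borel_prod[symmetric])

lemma space_torus: "space torus = {0..<2 * pi} \<times> {0..<2 * pi}"
  by (simp add: torus_def space_restrict_space)

lemma torus_measurable: "f \<in> borel_measurable borel \<Longrightarrow> f \<in> borel_measurable torus"
  unfolding torus_def by (rule measurable_restrict_space1) simp

lemma finite_measure_torus: "finite_measure torus"
proof
  have "emeasure torus (space torus) = emeasure lborel ({0..<2 * pi} \<times> {0..<2 * pi} :: (real \<times> real) set)"
    by (simp add: torus_def emeasure_restrict_space space_restrict_space sets_torus_borel)
  also have "\<dots> \<le> emeasure lborel (cbox (0, 0) (2 * pi, 2 * pi) :: (real \<times> real) set)"
    by (rule emeasure_mono) auto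
  also have "\<dots> < \<infinity>" using emeasure_lborel_cbox_finite by simp
  finally show "emeasure torus (space torus) \<noteq> \<infinity>" by simp
qed

lemma square_integrable_bounded:
  assumes "f \<in> borel_measurable torus" "\<And>z. z \<in> space torus \<Longrightarrow> cmod (f z) \<le> B"
  shows "square_integrable f"
  unfolding square_integrable_def
proof (intro conjI assms)
  show "integrable torus (\<lambda>z. (cmod (f z))\<^sup>2)"
  proof (rule finite_measure.integrable_const_bound[OF finite_measure_torus])
    show "AE z in torus. norm ((cmod (f z))\<^sup>2) \<le> B\<^sup>2"
      using assms(2) by (intro AE_I2) (auto intro!: power_mono)
  qed (use assms in measurable)
qed

lemma square_integrable_continuous:
  assumes "continuous_on UNIV f"
  shows "square_integrable f"
proof -
  have "bounded (f ` cbox (0, 0) (2 * pi, 2 * pi))"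
    by (intro compact_imp_bounded compact_continuous_image compact_cbox continuous_on_subset[OF assms]) simp
  then obtain B where "\<And>z. z \<in> cbox (0, 0) (2 * pi, 2 * pi) \<Longrightarrow> cmod (f z) \<le> B"
    by (auto simp: bounded_iff)
  then show ?thesis
    by (intro square_integrable_bounded[where B = B] torus_measurable borel_measurable_continuous_onI assms)
      (auto simp: space_torus)
qed

lemma L2_eq_refl_iff [simp]: "L2_eq f f \<longleftrightarrow> square_integrable f"
  by (simp add: L2_eq_def)

lemma to_L2_eqI:
  assumes "square_integrable f" "square_integrable g" "AE z in torus. f z = g z"
  shows "to_L2 f = to_L2 g"
  by (rule Quotient_rel_abs[OF Quotient_L2_torus]) (use assms in \<open>simp add: L2_eq_def\<close>)

lemma to_L2_cases:
  obtains \<phi> where "square_integrable \<phi>" "f = to_L2 \<phi>"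
proof -
  have "L2_eq (rep_L2 f) (rep_L2 f)" "to_L2 (rep_L2 f) = f"
    by (rule Quotient_rep_reflp[OF Quotient_L2_torus]) (rule Quotient_abs_rep[OF Quotient_L2_torus])
  then show ?thesis using that by (metis L2_eq_refl_iff)
qed

lemma to_L2_add: "square_integrable f \<Longrightarrow> square_integrable g \<Longrightarrow> to_L2 f + to_L2 g = to_L2 (\<lambda>z. f z + g z)"
  by (simp add: plus_L2_torus.abs_eq)

lemma to_L2_scaleC: "square_integrable f \<Longrightarrow> scaleC_L2 c (to_L2 f) = to_L2 (\<lambda>z. c * f z)"
  by (simp add: scaleC_L2.abs_eq)

lemma to_L2_diff:
  assumes "square_integrable f" "square_integrable g"
  shows "to_L2 f - to_L2 g = to_L2 (\<lambda>z. f z - g z)"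
  unfolding minus_L2_torus_def uminus_L2_torus_def to_L2_scaleC[OF assms(2)]
    to_L2_add[OF assms(1) square_integrable_scale[OF assms(2)]]
  by simp

lemma cinner_to_L2:
  "square_integrable f \<Longrightarrow> square_integrable g \<Longrightarrow>
    cinner_L2 (to_L2 f) (to_L2 g) = (\<integral>z. cnj (f z) * g z \<partial>torus)"
  by (simp add: cinner_L2.abs_eq)

lemma norm_to_L2:
  assumes "square_integrable f"
  shows "(norm (to_L2 f))\<^sup>2 = (\<integral>z. (cmod (f z))\<^sup>2 \<partial>torus)"
proof -
  have "(norm (to_L2 f))\<^sup>2 = Re (\<integral>z. cnj (f z) * f z \<partial>torus)"
    using assms by (simp add: power2_norm_eq_inner inner_L2_torus_def cinner_to_L2)
  also have "(\<lambda>z. cnj (f z) * f z) = (\<lambda>z. complex_of_real ((cmod (f z))\<^sup>2))"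
    by (simp only: complex_norm_square mult.commute)
  finally show ?thesis by (simp del: of_real_power)
qed

text \<open>The half-open square differs from the closed box by a negligible part of the boundary,
  and on the closed box the integral of a continuous function can be iterated.\<close>

lemma torus_integral_continuous:
  fixes h :: "real \<times> real \<Rightarrow> complex"
  assumes "continuous_on UNIV h"
  shows "(\<integral>z. h z \<partial>torus) = integral {0..2 * pi} (\<lambda>x. integral {0..2 * pi} (\<lambda>y. h (x, y)))"
proof -
  let ?B = "{0..<2 * pi} \<times> {0..<2 * pi} :: (real \<times> real) set"
  let ?C = "cbox (0, 0) (2 * pi, 2 * pi) :: (real \<times> real) set"
  have hC: "continuous_on A h" for A by (rule continuous_on_subset[OF assms]) simp
  have "set_integrable lborel ?C h"
    unfolding set_integrable_def by (rule borel_integrable_compact[OF compact_cbox hC])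
  then have "set_integrable lborel ?B h"
    by (rule set_integrable_subset) (auto simp: sets_torus_borel)
  then have "(LINT z:?B|lborel. h z) = integral ?B h"
    by (rule set_borel_integral_eq_integral(2))
  moreover have "(\<integral>z. h z \<partial>torus) = (LINT z:?B|lborel. h z)"
    unfolding torus_def set_lebesgue_integral_def
    by (rule Bochner_Integration.integral_restrict_space) (simp add: sets_torus_borel)
  moreover have "integral ?B h = integral ?C h"
  proof (rule integral_spike_set)
    have "negligible (?C - box (0, 0) (2 * pi, 2 * pi))" by (rule negligible_frontier_interval)
    then show "negligible {z \<in> ?C - ?B. h z \<noteq> 0}"
      by (rule negligible_subset) (auto simp: mem_box Basis_prod_def)
    show "negligible {z \<in> ?B - ?C. h z \<noteq> 0}"
      by (rule negligible_subset[OF negligible_empty]) auto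
  qed
  moreover have "integral ?C h = integral {0..2 * pi} (\<lambda>x. integral {0..2 * pi} (\<lambda>y. h (x, y)))"
    using integral_prod_continuous[OF hC, of 0 0 "2 * pi" "2 * pi"] by simp
  ultimately show ?thesis by simp
qed

section \<open>Families of smooth modes and their sums\<close>

lemma test_modesD:
  assumes "F \<in> test_modes"
  shows "smooth_circle (F m)" "finite {m. F m \<noteq> (\<lambda>y. 0)}"
  using assms by (auto simp: test_modes_def)

lemma test_modesI:
  assumes "\<And>m. smooth_circle (F m)" "finite M" "\<And>m. m \<notin> M \<Longrightarrow> F m = (\<lambda>y. 0)"
  shows "F \<in> test_modes"
  using assms finite_subset[of "{m. F m \<noteq> (\<lambda>y. 0)}" M] by (auto simp: test_modes_def)

lemma smooth_circle_continuous: "smooth_circle f \<Longrightarrow> continuous_on S f"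
  by (meson smooth_circle_iff smooth_on_continuous_on smooth_on_mono subset_UNIV)

lemma smooth_circle_0: "smooth_circle (\<lambda>y. 0)"
  by (simp add: smooth_circle_iff)

lemma smooth_circle_add: "smooth_circle f \<Longrightarrow> smooth_circle g \<Longrightarrow> smooth_circle (\<lambda>y. f y + g y)"
  by (auto simp: smooth_circle_iff intro: smooth_on_add)

lemma smooth_circle_mult:
  fixes f g :: "real \<Rightarrow> 'a::real_normed_algebra"
  shows "smooth_circle f \<Longrightarrow> smooth_circle g \<Longrightarrow> smooth_circle (\<lambda>y. f y * g y)"
  by (auto simp: smooth_circle_iff intro: smooth_on_mult)

lemma smooth_circle_const: "smooth_circle (\<lambda>y. c)"
  by (simp add: smooth_circle_iff)

text \<open>Any finite superset of the support may serve as index set, so that several families can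
  be summed over a common one.\<close>

lemma mode_sum_eq:
  assumes "finite M" "\<And>m. m \<notin> M \<Longrightarrow> F m = (\<lambda>y. 0)"
  shows "mode_sum F = (\<lambda>(x, y). \<Sum>m\<in>M. exp (\<i> * of_int m * of_real x) * F m y)"
  unfolding mode_sum_def
  by (intro ext, clarify, rule sum.mono_neutral_left) (use assms in auto)

lemma continuous_mode_sum:
  assumes "F \<in> test_modes"
  shows "continuous_on UNIV (mode_sum F)"
  unfolding mode_sum_def case_prod_unfold
  by (intro continuous_intros continuous_on_compose2[OF smooth_circle_continuous[OF test_modesD(1)[OF assms]]])
    auto

lemma square_integrable_mode_sum: "F \<in> test_modes \<Longrightarrow> square_integrable (mode_sum F)"
  by (intro square_integrable_continuous continuous_mode_sum)

lemma test_modes_add: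
  assumes "F \<in> test_modes" "G \<in> test_modes"
  shows "(\<lambda>m y. F m y + G m y) \<in> test_modes"
    "mode_sum (\<lambda>m y. F m y + G m y) = (\<lambda>z. mode_sum F z + mode_sum G z)"
proof -
  define M where "M = {m. F m \<noteq> (\<lambda>y. 0)} \<union> {m. G m \<noteq> (\<lambda>y. 0)}"
  have M: "finite M" using assms by (simp add: M_def test_modesD)
  show "(\<lambda>m y. F m y + G m y) \<in> test_modes"
  proof (rule test_modesI[OF _ M])
    show "smooth_circle (\<lambda>y. F m y + G m y)" for m
      by (intro smooth_circle_add test_modesD assms)
  qed (simp add: M_def)
  have "mode_sum F = (\<lambda>(x, y). \<Sum>m\<in>M. exp (\<i> * of_int m * of_real x) * F m y)"
    "mode_sum G = (\<lambda>(x, y). \<Sum>m\<in>M. exp (\<i> * of_int m * of_real x) * G m y)"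
    "mode_sum (\<lambda>m y. F m y + G m y) = (\<lambda>(x, y). \<Sum>m\<in>M. exp (\<i> * of_int m * of_real x) * (F m y + G m y))"
    by (intro mode_sum_eq M; force simp: M_def)+
  then show "mode_sum (\<lambda>m y. F m y + G m y) = (\<lambda>z. mode_sum F z + mode_sum G z)"
    by (simp add: fun_eq_iff sum.distrib distrib_left)
qed

lemma test_modes_mult:
  assumes "F \<in> test_modes" "\<And>m. smooth_circle (w m)"
  shows "(\<lambda>m y. w m y * F m y) \<in> test_modes"
  by (rule test_modesI[of _ "{m. F m \<noteq> (\<lambda>y. 0)}"])
    (use assms in \<open>auto intro: smooth_circle_mult test_modesD\<close>)

lemma mode_sum_scale:
  assumes "F \<in> test_modes"
  shows "mode_sum (\<lambda>m y. c * F m y) = (\<lambda>z. c * mode_sum F z)"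
proof -
  define M where "M = {m. F m \<noteq> (\<lambda>y. 0)}"
  have M: "finite M" using assms by (simp add: M_def test_modesD)
  have "mode_sum F = (\<lambda>(x, y). \<Sum>m\<in>M. exp (\<i> * of_int m * of_real x) * F m y)"
    "mode_sum (\<lambda>m y. c * F m y) = (\<lambda>(x, y). \<Sum>m\<in>M. exp (\<i> * of_int m * of_real x) * (c * F m y))"
    by (intro mode_sum_eq M; force simp: M_def)+
  then show ?thesis by (simp add: fun_eq_iff sum_distrib_left mult.left_commute)
qed

lemma integral_exp_int:
  "integral {0..2 * pi} (\<lambda>x. exp (\<i> * of_int k * of_real x)) = (if k = 0 then 2 * of_real pi else 0)"
proof (cases "k = 0")
  case False
  define c where "c = \<i> * of_int k"
  have c: "c \<noteq> 0" using False by (simp add: c_def)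
  have "((\<lambda>x. exp (c * of_real x)) has_integral exp (c * of_real (2 * pi)) / c - exp (c * of_real 0) / c) {0..2 * pi}"
    by (rule fundamental_theorem_of_calculus)
      (use c in \<open>auto intro!: derivative_eq_intros has_vector_derivative_real_field simp: field_simps\<close>)
  moreover have "exp (c * of_real (2 * pi)) = 1"
    using exp_integer_2pi[of "of_int k"] by (simp add: c_def mult_ac)
  ultimately show ?thesis using False by (simp add: c_def has_integral_iff)
qed (simp add: scaleR_conv_of_real)

text \<open>Parseval's identity in \<open>x\<close> alone: orthogonality of the exponentials removes
  the cross terms, and \<open>y\<close> remains as an integral for each mode.\<close>

lemma cinner_modes:
  assumes F: "F \<in> test_modes" and G: "G \<in> test_modes" and M: "finite M"
    "\<And>m. m \<notin> M \<Longrightarrow> F m = (\<lambda>y. 0)" "\<And>m. m \<notin> M \<Longrightarrow> G m = (\<lambda>y. 0)"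
  shows "cinner_L2 (to_L2 (mode_sum F)) (to_L2 (mode_sum G)) =
    2 * of_real pi * (\<Sum>m\<in>M. integral {0..2 * pi} (\<lambda>y. cnj (F m y) * G m y))"
proof -
  let ?e = "\<lambda>k x. exp (\<i> * of_int k * of_real x) :: complex"
  have FG: "continuous_on A (F m)" "continuous_on A (G m)" for A m
    using F G by (auto intro: smooth_circle_continuous test_modesD)
  have "continuous_on UNIV (\<lambda>z. cnj (mode_sum F z) * mode_sum G z)"
    by (intro continuous_intros continuous_mode_sum F G)
  then have "cinner_L2 (to_L2 (mode_sum F)) (to_L2 (mode_sum G)) =
      integral {0..2 * pi} (\<lambda>x. integral {0..2 * pi} (\<lambda>y. cnj (mode_sum F (x, y)) * mode_sum G (x, y)))"
    using F G by (simp add: cinner_to_L2 square_integrable_mode_sum torus_integral_continuous)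
  also have "\<dots> = integral {0..2 * pi} (\<lambda>x. \<Sum>m\<in>M. \<Sum>k\<in>M. ?e (k - m) x * integral {0..2 * pi} (\<lambda>y. cnj (F m y) * G k y))"
  proof (rule integral_cong)
    fix x :: real
    have "cnj (mode_sum F (x, y)) * mode_sum G (x, y) = (\<Sum>m\<in>M. \<Sum>k\<in>M. ?e (k - m) x * (cnj (F m y) * G k y))" for y
    proof -
      have "mode_sum F (x, y) = (\<Sum>m\<in>M. ?e m x * F m y)" "mode_sum G (x, y) = (\<Sum>k\<in>M. ?e k x * G k y)"
        by (simp_all add: mode_sum_eq[OF M(1,2)] mode_sum_eq[OF M(1,3)])
      then show ?thesis
        by (simp add: sum_product)
          (intro sum.cong refl, simp add: exp_cnj algebra_simps exp_diff exp_minus divide_inverse)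
    qed
    then show "integral {0..2 * pi} (\<lambda>y. cnj (mode_sum F (x, y)) * mode_sum G (x, y)) =
        (\<Sum>m\<in>M. \<Sum>k\<in>M. ?e (k - m) x * integral {0..2 * pi} (\<lambda>y. cnj (F m y) * G k y))"
      by (simp add: integral_sum M(1) integrable_continuous_interval continuous_intros FG)
  qed
  also have "\<dots> = (\<Sum>m\<in>M. \<Sum>k\<in>M. integral {0..2 * pi} (?e (k - m)) * integral {0..2 * pi} (\<lambda>y. cnj (F m y) * G k y))"
    by (simp add: integral_sum M(1) integrable_continuous_interval continuous_intros)
  also have "\<dots> = (\<Sum>m\<in>M. \<Sum>k\<in>M. if k = m then 2 * of_real pi * integral {0..2 * pi} (\<lambda>y. cnj (F m y) * G m y) else 0)"
    by (intro sum.cong refl) (simp only: integral_exp_int, simp)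
  also have "\<dots> = 2 * of_real pi * (\<Sum>m\<in>M. integral {0..2 * pi} (\<lambda>y. cnj (F m y) * G m y))"
    by (simp add: M(1) sum_distrib_left)
  finally show ?thesis .
qed

text \<open>This is what gives the definite description \<open>modes\<close> its meaning. By
  \<open>cinner_modes\<close> the squared norm of the difference is a sum of integrals of continuous
  nonnegative functions; each vanishes, and periodicity extends the result from one period to the
  line.\<close>

lemma mode_sum_inject:
  assumes F: "F \<in> test_modes" and G: "G \<in> test_modes" and eq: "to_L2 (mode_sum F) = to_L2 (mode_sum G)"
  shows "F = G"
proof -
  define D where "D = (\<lambda>m y. F m y + (-1) * G m y)"
  have nG: "(\<lambda>m y. (-1) * G m y) \<in> test_modes"
    by (rule test_modes_mult[OF G]) (rule smooth_circle_const)
  have D: "D \<in> test_modes" unfolding D_def by (rule test_modes_add(1)[OF F nG])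
  have "mode_sum D = (\<lambda>z. mode_sum F z - mode_sum G z)"
    using test_modes_add(2)[OF F nG] mode_sum_scale[OF G, of "-1"] by (simp add: D_def)
  then have "to_L2 (mode_sum D) = 0"
    using eq to_L2_diff[OF square_integrable_mode_sum[OF F] square_integrable_mode_sum[OF G]] by simp
  then have "cinner_L2 (to_L2 (mode_sum D)) (to_L2 (mode_sum D)) = 0"
    by (simp add: zero_L2_torus_def cinner_to_L2 square_integrable_zero)
  note D0 = this
  define M where "M = {m. D m \<noteq> (\<lambda>y. 0)}"
  have M: "finite M" using D by (simp add: M_def test_modesD)
  have DM: "D m = (\<lambda>y. 0)" if "m \<notin> M" for m using that by (simp add: M_def)
  have 0: "(\<Sum>m\<in>M. integral {0..2 * pi} (\<lambda>y. cnj (D m y) * D m y)) = 0"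
  proof -
    have "2 * of_real pi * (\<Sum>m\<in>M. integral {0..2 * pi} (\<lambda>y. cnj (D m y) * D m y)) = 0"
      unfolding D0[symmetric] by (rule cinner_modes[OF D D M, symmetric]) (erule DM)+
    then show ?thesis by simp
  qed
  have cont: "continuous_on A (D m)" for A m using D by (auto intro: smooth_circle_continuous test_modesD)
  have "integral {0..2 * pi} (\<lambda>y. cnj (D m y) * D m y) = of_real (integral {0..2 * pi} (\<lambda>y. (cmod (D m y))\<^sup>2))" for m
  proof -
    have "(\<lambda>y. cnj (D m y) * D m y) = (\<lambda>y. complex_of_real ((cmod (D m y))\<^sup>2))"
      by (simp only: complex_norm_square mult.commute)
    then show ?thesis
      using integral_linear[of "\<lambda>y. (cmod (D m y))\<^sup>2" "{0..2 * pi}" complex_of_real]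
      by (simp add: bounded_linear_of_real integrable_continuous_interval continuous_intros cont o_def
          del: of_real_power)
  qed
  with 0 have "(\<Sum>m\<in>M. integral {0..2 * pi} (\<lambda>y. (cmod (D m y))\<^sup>2)) = 0"
    by (simp flip: of_real_sum)
  then have int0: "integral {0..2 * pi} (\<lambda>y. (cmod (D m y))\<^sup>2) = 0" if "m \<in> M" for m
    using that M by (subst (asm) sum_nonneg_eq_0_iff)
      (auto intro!: integral_nonneg integrable_continuous_interval continuous_intros cont)
  have "D m y = 0" if "m \<in> M" for m y
  proof -
    have per: "D m (y + 2 * pi) = D m y" for y
      using test_modesD(1)[OF D] by (simp add: smooth_circle_iff)
    obtain k :: int where k: "\<bar>y - 2 * pi * of_int k - pi\<bar> \<le> pi" by (rule shift_into_period)
    have "\<forall>x\<in>{0..2 * pi}. (cmod (D m x))\<^sup>2 = 0"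
      using int0[OF that] by (subst (asm) integral_eq_0_iff) (auto intro!: continuous_intros cont)
    moreover have "y - 2 * pi * of_int k \<in> {0..2 * pi}" using k by (auto simp: abs_le_iff)
    ultimately have "D m (y - 2 * pi * of_int k) = 0" by simp
    then show ?thesis using periodic_int[of "D m" "y - 2 * pi * of_int k" k, OF per] by simp
  qed
  then have "D m y = 0" for m y by (cases "m \<in> M") (auto simp: M_def)
  then show ?thesis by (simp add: D_def fun_eq_iff)
qed

lemma modes_mode_sum:
  assumes "F \<in> test_modes"
  shows "modes (to_L2 (mode_sum F)) = F"
  unfolding modes_def by (rule the_equality) (use assms mode_sum_inject in auto)

section \<open>Density of the test space\<close>

lemma AE_torus_not_negligible:
  assumes "negligible N"
  shows "AE z in torus. z \<notin> N"
proof -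
  have "AE z in lebesgue. z \<notin> N"
    using assms by (intro AE_not_in) (simp add: negligible_iff_null_sets)
  then have "AE z in lborel. z \<notin> N" by (simp add: AE_completion_iff)
  then show ?thesis
    unfolding torus_def by (subst AE_restrict_space_iff) (auto simp: sets_torus_borel)
qed

text \<open>Each approximation below goes through this form of dominated convergence. The limit
  inherits the bound \<open>w\<close>, so the squared error is at most
  \<open>4 * (w z)\<^sup>2\<close>.\<close>

lemma to_L2_closure_limit:
  assumes f: "\<And>k. square_integrable (f k)" "\<And>k. to_L2 (f k) \<in> closure A" and g: "square_integrable g"
    and lim: "AE z in torus. (\<lambda>k. f k z) \<longlonglongrightarrow> g z"
    and bound: "\<And>k. AE z in torus. cmod (f k z) \<le> w z" and w: "integrable torus (\<lambda>z. (w z)\<^sup>2)"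
  shows "to_L2 g \<in> closure A"
proof (rule closed_sequentially[OF closed_closure f(2)])
  have "(\<lambda>k. (norm (to_L2 (f k) - to_L2 g))\<^sup>2) \<longlonglongrightarrow> 0"
  proof -
    have meas: "f k \<in> borel_measurable torus" "g \<in> borel_measurable torus" for k
      using f(1) g by (auto simp: square_integrable_def)
    have sq: "square_integrable (\<lambda>z. f k z - g z)" for k
      using square_integrable_add[OF f(1) square_integrable_scale[OF g, of "-1"]] by simp
    have "(\<lambda>k. \<integral>z. (cmod (f k z - g z))\<^sup>2 \<partial>torus) \<longlonglongrightarrow> (\<integral>z. 0 \<partial>torus)"
    proof (rule integral_dominated_convergence)
      show "integrable torus (\<lambda>z. 4 * (w z)\<^sup>2)" using w by simp
      show "(\<lambda>z. (cmod (f k z - g z))\<^sup>2) \<in> borel_measurable torus" for k using meas by measurable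
      show "AE z in torus. (\<lambda>k. (cmod (f k z - g z))\<^sup>2) \<longlonglongrightarrow> 0"
        using lim
      proof eventually_elim
        case (elim z)
        have "(\<lambda>k. (cmod (f k z - g z))\<^sup>2) \<longlonglongrightarrow> (cmod (g z - g z))\<^sup>2"
          by (intro tendsto_intros elim)
        then show ?case by simp
      qed
      have all: "AE z in torus. \<forall>k. cmod (f k z) \<le> w z" using bound by (simp add: AE_all_countable)
      show "AE z in torus. norm ((cmod (f k z - g z))\<^sup>2) \<le> 4 * (w z)\<^sup>2" for k
        using all lim
      proof eventually_elim
        case (elim z)
        have "cmod (g z) \<le> w z"
          by (rule LIMSEQ_le_const2[OF tendsto_norm[OF elim(2)]]) (use elim(1) in auto)
        then have "cmod (f k z - g z) \<le> 2 * w z"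
          using norm_triangle_ineq4[of "f k z" "g z"] elim(1)[rule_format, of k] by linarith
        then have "(cmod (f k z - g z))\<^sup>2 \<le> (2 * w z)\<^sup>2" by (rule power_mono) simp
        then show ?case by (simp add: power_mult_distrib)
      qed
    qed simp
    then show ?thesis by (simp add: to_L2_diff f g norm_to_L2 sq)
  qed
  then have "(\<lambda>k. sqrt ((norm (to_L2 (f k) - to_L2 g))\<^sup>2)) \<longlonglongrightarrow> sqrt 0" by (rule tendsto_real_sqrt)
  then show "(\<lambda>k. to_L2 (f k)) \<longlonglongrightarrow> to_L2 g"
    by (simp add: tendsto_norm_zero_iff LIM_zero_iff)
qed

section \<open>Trigonometric polynomials and uniform approximation\<close>

lemma smooth_circle_exp: "smooth_circle (\<lambda>y. exp (\<i> * of_int l * of_real y) :: complex)"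
  using smooth_on_exp[of "\<i> * of_int l"] exp_integer_2pi[of "of_int l"]
  by (simp add: smooth_circle_iff distrib_left exp_add mult_ac)

text \<open>Generated by monomials and sums alone, so that each instance is readily a finite sum of
  modes. Closure under products, which polynomials demand, is derived afterwards.\<close>

inductive trig_poly :: "(real \<times> real \<Rightarrow> complex) \<Rightarrow> bool" where
  monomial: "trig_poly (\<lambda>z. c * exp (\<i> * of_int m * of_real (fst z)) * exp (\<i> * of_int l * of_real (snd z)))"
| add: "trig_poly f \<Longrightarrow> trig_poly g \<Longrightarrow> trig_poly (\<lambda>z. f z + g z)"

lemma trig_poly_mult:
  assumes "trig_poly f" "trig_poly g"
  shows "trig_poly (\<lambda>z. f z * g z)"
  using assms
proof (induction arbitrary: g)
  case (monomial c m l)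
  from monomial.prems show ?case
  proof induction
    case (monomial c' m' l')
    have "(\<lambda>z. c * exp (\<i> * of_int m * of_real (fst z)) * exp (\<i> * of_int l * of_real (snd z)) *
        (c' * exp (\<i> * of_int m' * of_real (fst z)) * exp (\<i> * of_int l' * of_real (snd z)))) =
      (\<lambda>z. (c * c') * exp (\<i> * of_int (m + m') * of_real (fst z)) * exp (\<i> * of_int (l + l') * of_real (snd z)))"
      by (simp add: fun_eq_iff distrib_left distrib_right exp_add mult_ac)
    then show ?case by (simp only: trig_poly.monomial)
  next
    case (add f g)
    then show ?case by (simp only: distrib_left trig_poly.add)
  qed
next
  case (add f h)
  then show ?case by (simp only: distrib_right trig_poly.add)
qed

lemma trig_poly_const: "trig_poly (\<lambda>z. c)"
  using trig_poly.monomial[of c 0 0] by simp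

lemma trig_poly_mode_sum:
  assumes "trig_poly f"
  shows "\<exists>F\<in>test_modes. f = mode_sum F"
  using assms
proof induction
  case (monomial c m l)
  define F where "F = (\<lambda>k y. if k = m then c * exp (\<i> * of_int l * of_real y) else 0)"
  have "F \<in> test_modes"
  proof (rule test_modesI[of _ "{m}"])
    show "smooth_circle (F k)" for k
      by (cases "k = m")
        (auto simp: F_def intro: smooth_circle_mult smooth_circle_exp smooth_circle_const)
  qed (auto simp: F_def)
  moreover have "mode_sum F = (\<lambda>(x, y). \<Sum>k\<in>{m}. exp (\<i> * of_int k * of_real x) * F k y)"
    by (rule mode_sum_eq) (auto simp: F_def)
  then have "mode_sum F = (\<lambda>z. c * exp (\<i> * of_int m * of_real (fst z)) * exp (\<i> * of_int l * of_real (snd z)))"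
    by (simp add: F_def fun_eq_iff mult_ac)
  ultimately show ?case by (intro bexI[of _ F]) simp_all
next
  case (add f g)
  then obtain F G where FG: "F \<in> test_modes" "G \<in> test_modes" "f = mode_sum F" "g = mode_sum G" by auto
  then have "(\<lambda>z. f z + g z) = mode_sum (\<lambda>m y. F m y + G m y)" by (simp add: test_modes_add)
  then show ?case using test_modes_add(1)[OF FG(1,2)] by blast
qed

lemma trig_poly_cos_sin:
  "trig_poly (\<lambda>z. of_real (cos (fst z)))" "trig_poly (\<lambda>z. of_real (sin (fst z)))"
  "trig_poly (\<lambda>z. of_real (cos (snd z)))" "trig_poly (\<lambda>z. of_real (sin (snd z)))"
proof -
  have c: "complex_of_real (cos x) = 1 / 2 * exp (\<i> * of_int 1 * of_real x) + 1 / 2 * exp (\<i> * of_int (-1) * of_real x)"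
    and s: "complex_of_real (sin x) = 1 / (2 * \<i>) * exp (\<i> * of_int 1 * of_real x) + (- 1) / (2 * \<i>) * exp (\<i> * of_int (-1) * of_real x)" for x
    by (simp_all add: cos_of_real[symmetric] sin_of_real[symmetric] cos_exp_eq sin_exp_eq field_simps)
  note x = trig_poly.monomial[of _ _ 0, simplified mult_zero_left of_int_0 mult_zero_right exp_zero mult_1_right]
    and y = trig_poly.monomial[of _ 0, simplified mult_zero_left of_int_0 mult_zero_right exp_zero mult_1_right]
  show "trig_poly (\<lambda>z. of_real (cos (fst z)))" "trig_poly (\<lambda>z. of_real (sin (fst z)))"
    "trig_poly (\<lambda>z. of_real (cos (snd z)))" "trig_poly (\<lambda>z. of_real (sin (snd z)))"
    unfolding c s by (intro trig_poly.add x y)+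
qed

lemma trig_poly_polynomial:
  fixes q :: "complex \<times> complex \<Rightarrow> real"
  assumes "real_polynomial_function q"
  shows "trig_poly (\<lambda>z. of_real (q (cis (fst z), cis (snd z))))"
  using assms
proof induction
  case (linear f)
  interpret f: bounded_linear f by fact
  have expand: "f (z, w) = Re z * f (1, 0) + Im z * f (\<i>, 0) + Re w * f (0, 1) + Im w * f (0, \<i>)" for z w
  proof -
    have "(z, w) = Re z *\<^sub>R (1, 0) + Im z *\<^sub>R (\<i>, 0) + Re w *\<^sub>R (0, 1) + Im w *\<^sub>R (0, \<i>)"
      by (simp add: complex_eq_iff)
    then show ?thesis by (simp only: f.add f.scaleR real_scaleR_def)
  qed
  have "of_real (f (cis x, cis y)) =
      of_real (cos x) * of_real (f (1, 0)) + of_real (sin x) * of_real (f (\<i>, 0)) +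
      of_real (cos y) * of_real (f (0, 1)) + (of_real (sin y) * of_real (f (0, \<i>)) :: complex)" for x y
    unfolding expand[of "cis x" "cis y"] by simp
  then show ?case
    by (simp only:) (intro trig_poly.add trig_poly_mult trig_poly_const trig_poly_cos_sin)
next
  case (const c)
  show ?case by (rule trig_poly_const)
next
  case (add f g)
  then show ?case by (simp add: trig_poly.add)
next
  case (mult f g)
  then show ?case by (simp add: trig_poly_mult)
qed

lemma to_L2_continuous_circle:
  fixes G :: "complex \<times> complex \<Rightarrow> complex"
  assumes G: "continuous_on (sphere 0 1 \<times> sphere 0 1) G"
  shows "to_L2 (\<lambda>z. G (cis (fst z), cis (snd z))) \<in> closure \<Phi>"
proof -
  let ?S = "sphere 0 1 \<times> sphere 0 1 :: (complex \<times> complex) set"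
  let ?c = "\<lambda>z. (cis (fst z), cis (snd z))"
  have cS: "?c z \<in> ?S" for z :: "real \<times> real" by simp
  have compS: "compact ?S" by (intro compact_Times) auto
  have "continuous_on UNIV (\<lambda>z. G (?c z))"
    by (rule continuous_on_compose2[OF G]) (auto intro!: continuous_intros)
  then have sqG: "square_integrable (\<lambda>z. G (?c z))" by (rule square_integrable_continuous)
  \<comment> \<open>Approximation takes place on the circles and not in the angles: polynomials
    there are periodic in the angles and become trigonometric polynomials.\<close>
  have "\<exists>q. polynomial_function q \<and> (\<forall>x\<in>?S. cmod (G x - q x) < inverse (real (Suc k)))" for k
    by (rule Stone_Weierstrass_polynomial_function[OF compS G]) simp
  then obtain q where q: "\<And>k. polynomial_function (q k)"
    "\<And>k x. x \<in> ?S \<Longrightarrow> cmod (G x - q k x) < inverse (real (Suc k))"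
    by metis
  have "bounded (G ` ?S)" by (intro compact_imp_bounded compact_continuous_image G compS)
  then obtain B where B: "\<And>x. x \<in> ?S \<Longrightarrow> cmod (G x) \<le> B" by (auto simp: bounded_iff)
  have "trig_poly (\<lambda>z. q k (?c z))" for k
  proof -
    have "real_polynomial_function (Re \<circ> q k)" "real_polynomial_function (Im \<circ> q k)"
      using q(1)[of k] by (auto simp: polynomial_function_def bounded_linear_Re bounded_linear_Im)
    note this[THEN trig_poly_polynomial]
    then have "trig_poly (\<lambda>z. of_real (Re (q k (?c z))) + \<i> * of_real (Im (q k (?c z))))"
      by (intro trig_poly.add trig_poly_mult trig_poly_const) simp_all
    then show ?thesis by (simp flip: complex_eq)
  qed
  then have "\<forall>k. \<exists>F. F \<in> test_modes \<and> (\<lambda>z. q k (?c z)) = mode_sum F"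
    using trig_poly_mode_sum by blast
  then have "\<exists>F. \<forall>k. F k \<in> test_modes \<and> (\<lambda>z. q k (?c z)) = mode_sum (F k)" by (rule choice)
  then obtain F where F: "\<And>k. F k \<in> test_modes" "\<And>k. (\<lambda>z. q k (?c z)) = mode_sum (F k)"
    by auto
  show ?thesis
  proof (rule to_L2_closure_limit[where f = "\<lambda>k. mode_sum (F k)" and w = "\<lambda>z. B + 1"])
    show "square_integrable (mode_sum (F k))" for k by (rule square_integrable_mode_sum[OF F(1)])
    show "to_L2 (mode_sum (F k)) \<in> closure \<Phi>" for k
      using F(1)[of k] closure_subset[of "\<Phi>"] by (auto simp: test_space_def)
    have d: "cmod (G (?c z) - mode_sum (F k) z) < inverse (real (Suc k))" for k z
      using q(2)[OF cS, of z k] fun_cong[OF F(2)[of k], of z] by simp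
    show "AE z in torus. (\<lambda>k. mode_sum (F k) z) \<longlonglongrightarrow> G (?c z)"
    proof (rule AE_I2)
      fix z
      have "(\<lambda>k. G (?c z) - mode_sum (F k) z) \<longlonglongrightarrow> 0"
        by (rule Lim_null_comparison[OF _ LIMSEQ_inverse_real_of_nat])
          (intro always_eventually allI less_imp_le d)
      from tendsto_diff[OF tendsto_const[of "G (?c z)"] this]
      show "(\<lambda>k. mode_sum (F k) z) \<longlonglongrightarrow> G (?c z)" by simp
    qed
    show "AE z in torus. cmod (mode_sum (F k) z) \<le> B + 1" for k
    proof (rule AE_I2)
      fix z
      have "inverse (real (Suc k)) \<le> 1" by (simp add: inverse_eq_divide)
      then show "cmod (mode_sum (F k) z) \<le> B + 1"
        using B[OF cS, of z] d[of z k] norm_triangle_ineq2[of "mode_sum (F k) z" "G (?c z)"]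
        by (simp add: norm_minus_commute)
    qed
    show "integrable torus (\<lambda>z. (B + 1)\<^sup>2)"
      using finite_measure_torus by (simp add: finite_measure.integrable_const)
  qed (rule sqG)
qed

lemma cis_eq_1_iff_period: "0 \<le> x \<Longrightarrow> x < 2 * pi \<Longrightarrow> cis x = 1 \<longleftrightarrow> x = 0"
proof
  assume "0 \<le> x" "x < 2 * pi" "cis x = 1"
  then obtain k :: int where k: "x = k * 2 * pi"
    using cos_one_2pi_int[of x] by (auto simp: complex_eq_iff)
  with \<open>0 \<le> x\<close> \<open>x < 2 * pi\<close> have "0 \<le> real_of_int k" "real_of_int k < 1"
    using pi_gt_zero by (auto simp: zero_le_mult_iff simp del: pi_gt_zero)
  then have "k = 0" by linarith
  with k show "x = 0" by simp
qed simp

text \<open>\<open>g\<close> need not be periodic, so it need not descend to the circles. Cutoffs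
  that vanish where an angle is \<open>0\<close> remove the jump, and they tend to \<open>1\<close>
  off these lines, which are negligible.\<close>

lemma to_L2_bounded_continuous:
  fixes g :: "real \<times> real \<Rightarrow> complex"
  assumes g: "continuous_on UNIV g" and B: "\<And>z. cmod (g z) \<le> B"
  shows "to_L2 g \<in> closure \<Phi>"
proof -
  have B0: "0 \<le> B" using B[of 0] norm_ge_zero order_trans by blast
  define c where "c = (\<lambda>j z. min 1 (real j * cmod (z - 1)))"
  have c: "0 \<le> c j z" "c j z \<le> 1" "c j 1 = 0" for j z by (auto simp: c_def)
  have ccont: "isCont (c j) z" for j z unfolding c_def by (intro continuous_intros)
  define G where "G = (\<lambda>j u. of_real (c j (fst u) * c j (snd u)) * g (Arg2pi (fst u), Arg2pi (snd u)))"
  have "continuous (at (z, w) within sphere 0 1 \<times> sphere 0 1) (G j)"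
    if "z \<in> sphere 0 1" "w \<in> sphere 0 1" for j z w
  \<comment> \<open>\<open>Arg2pi\<close> jumps at \<open>1\<close>; there \<open>G j\<close> is
    squeezed to \<open>0\<close> by the bound on \<open>g\<close> and the vanishing cutoff.\<close>
  proof (cases "z = 1 \<or> w = 1")
    case True
    have "isCont (\<lambda>u. B * (c j (fst u) * c j (snd u))) (z, w)"
      by (intro continuous_intros continuous_at_compose[of _ fst "c j", unfolded o_def]
          continuous_at_compose[of _ snd "c j", unfolded o_def]) (auto simp: ccont)
    then have lim: "((\<lambda>u. B * (c j (fst u) * c j (snd u))) \<longlongrightarrow> 0) (at (z, w))"
      using True c(3) by (auto simp: isCont_def)
    have "(G j \<longlongrightarrow> 0) (at (z, w))"
    proof (rule Lim_null_comparison[OF _ lim], rule always_eventually, rule allI)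
      fix u
      have "cmod (G j u) = c j (fst u) * c j (snd u) * cmod (g (Arg2pi (fst u), Arg2pi (snd u)))"
        by (simp add: G_def norm_mult c)
      also have "\<dots> \<le> c j (fst u) * c j (snd u) * B"
        by (intro mult_left_mono B mult_nonneg_nonneg c)
      finally show "cmod (G j u) \<le> B * (c j (fst u) * c j (snd u))" by (simp add: mult_ac)
    qed
    moreover have "G j (z, w) = 0" using True c(3) by (auto simp: G_def)
    ultimately have "isCont (G j) (z, w)" by (simp add: isCont_def)
    then show ?thesis by (rule continuous_at_imp_continuous_within)
  next
    case False
    have "z \<notin> \<real>\<^sub>\<ge>\<^sub>0" "w \<notin> \<real>\<^sub>\<ge>\<^sub>0"
      using that False by (auto elim!: nonneg_Reals_cases)
    then have A: "isCont Arg2pi z" "isCont Arg2pi w" by (auto intro: continuous_at_Arg2pi)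
    have gi: "isCont g u" for u using g by (cases u) (simp add: continuous_on_eq_continuous_at)
    have comp: "isCont (\<lambda>u. h (fst u)) (z, w)" if "isCont h z" for h :: "complex \<Rightarrow> real"
      by (rule isCont_o2[OF continuous_fst[OF continuous_ident]]) (simp add: that)
    have comp': "isCont (\<lambda>u. h (snd u)) (z, w)" if "isCont h w" for h :: "complex \<Rightarrow> real"
      by (rule isCont_o2[OF continuous_snd[OF continuous_ident]]) (simp add: that)
    have "isCont (G j) (z, w)" unfolding G_def
      by (intro continuous_mult isCont_of_real isCont_o2[OF continuous_Pair gi] comp comp' A ccont)
    then show ?thesis by (rule continuous_at_imp_continuous_within)
  qed
  then have "continuous_on (sphere 0 1 \<times> sphere 0 1) (G j)" for j
    by (auto simp: continuous_on_eq_continuous_within)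
  then have cl: "to_L2 (\<lambda>z. G j (cis (fst z), cis (snd z))) \<in> closure \<Phi>" for j
    by (rule to_L2_continuous_circle)
  define h where "h = (\<lambda>j z. of_real (c j (cis (fst z)) * c j (cis (snd z))) * g z)"
  have hcont: "continuous_on UNIV (h j)" for j
    unfolding h_def c_def by (intro continuous_intros g)
  have Arg: "Arg2pi (cis x) = x" if "0 \<le> x" "x < 2 * pi" for x
    using that by (intro Arg2pi_unique[of 1]) (auto simp: cis_conv_exp)
  have Gh: "G j (cis (fst z), cis (snd z)) = h j z" if "z \<in> space torus" for j z
    using that by (cases z) (auto simp: space_torus G_def h_def Arg)
  have hB: "cmod (h j z) \<le> B" for j z
  proof -
    have "c j (cis (fst z)) * c j (cis (snd z)) * cmod (g z) \<le> 1 * B"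
      by (intro mult_mono B mult_le_one c mult_nonneg_nonneg) auto
    then show ?thesis by (simp add: h_def norm_mult c)
  qed
  show ?thesis
  proof (rule to_L2_closure_limit[where f = h and w = "\<lambda>z. B"])
    show sqh: "square_integrable (h j)" for j by (rule square_integrable_continuous[OF hcont])
    show "to_L2 (h j) \<in> closure \<Phi>" for j
    proof -
      have "square_integrable (\<lambda>z. G j (cis (fst z), cis (snd z)))"
        using sqh[of j] Gh unfolding square_integrable_def
        by (simp cong: measurable_cong Bochner_Integration.integrable_cong)
      then have "to_L2 (h j) = to_L2 (\<lambda>z. G j (cis (fst z), cis (snd z)))"
        by (intro to_L2_eqI sqh) (auto simp: Gh)
      then show ?thesis using cl by simp
    qed
    show "square_integrable g" by (rule square_integrable_continuous[OF g])
    have "negligible {z :: real \<times> real. (1, 0) \<bullet> z = 0}" "negligible {z :: real \<times> real. (0, 1) \<bullet> z = 0}"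
      by (rule negligible_hyperplane; simp add: zero_prod_def)+
    from this[THEN AE_torus_not_negligible] AE_space
    show "AE z in torus. (\<lambda>j. h j z) \<longlonglongrightarrow> g z"
    proof eventually_elim
      case (elim z)
      obtain x y where z: "z = (x, y)" by (cases z)
      with elim have "cis x \<noteq> 1" "cis y \<noteq> 1" by (auto simp: space_torus cis_eq_1_iff_period)
      moreover have "(\<lambda>j. c j u) \<longlonglongrightarrow> 1" if "u \<noteq> 1" for u
      proof -
        have "\<forall>\<^sub>F j in sequentially. real j \<ge> inverse (cmod (u - 1))"
          using filterlim_real_sequentially by (simp add: filterlim_at_top)
        then have "\<forall>\<^sub>F j in sequentially. c j u = 1"
          by eventually_elim (use that in \<open>auto simp: c_def field_simps min_def\<close>)
        then show ?thesis by (rule tendsto_eventually)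
      qed
      ultimately have "(\<lambda>j. of_real (c j (cis x) * c j (cis y)) * g z) \<longlonglongrightarrow> of_real (1 * 1) * g z"
        by (intro tendsto_intros)
      then show ?case by (simp add: h_def z)
    qed
    show "AE z in torus. cmod (h j z) \<le> B" for j by (simp add: hB)
    show "integrable torus (\<lambda>z. B\<^sup>2)"
      using finite_measure_torus by (simp add: finite_measure.integrable_const)
  qed
qed

theorem closure_test_space: "closure \<Phi> = UNIV"
proof -
  have "f \<in> closure \<Phi>" for f
  proof -
    obtain \<phi> where sq: "square_integrable \<phi>" and f: "f = to_L2 \<phi>" by (rule to_L2_cases)
    then have meas: "\<phi> \<in> borel_measurable torus" by (simp add: square_integrable_def)
    then have "(\<lambda>z. indicator ({0..<2 * pi} \<times> {0..<2 * pi}) z *\<^sub>R \<phi> z) \<in> borel_measurable lborel"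
      unfolding torus_def
      by (subst (asm) borel_measurable_restrict_space_iff) (auto simp: sets_torus_borel)
    then have "(\<lambda>z. indicator ({0..<2 * pi} \<times> {0..<2 * pi}) z *\<^sub>R \<phi> z) \<in> borel_measurable lebesgue"
      by (rule measurable_completion)
    then have "(\<lambda>z. indicator ({0..<2 * pi} \<times> {0..<2 * pi}) z *\<^sub>R \<phi> z) measurable_on UNIV"
      by (rule lebesgue_measurable_imp_measurable_on) simp
    then obtain N g where N: "negligible N" and g: "\<And>k. continuous_on UNIV (g k)"
      and lim: "\<And>z. z \<notin> N \<Longrightarrow> (\<lambda>k. g k z) \<longlonglongrightarrow> indicator ({0..<2 * pi} \<times> {0..<2 * pi}) z *\<^sub>R \<phi> z"
      unfolding measurable_on_def by auto
    \<comment> \<open>The continuous functions \<open>g k\<close> converge almost everywhere but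
      have no common bound; radial truncation to the disc of radius \<open>Suc n\<close> supplies
      one. The limit in \<open>k\<close> is taken for fixed \<open>n\<close>, and then the limit in
      \<open>n\<close>, dominated by \<open>cmod (\<phi> z)\<close>.\<close>
    define cl where "cl = (\<lambda>n z. z * of_real (real (Suc n) / max (real (Suc n)) (cmod z)))"
    have clcont: "continuous_on UNIV (cl n)" for n
      unfolding cl_def by (intro continuous_intros) (auto simp: max_def)
    have clB: "cmod (cl n z) \<le> real (Suc n)" "cmod (cl n z) \<le> cmod z" for n z
      by (auto simp: cl_def norm_mult norm_divide max_def field_simps simp del: of_nat_Suc)
    have cleq: "cl n z = z" if "cmod z \<le> real (Suc n)" for n z
      using that by (simp add: cl_def max_def del: of_nat_Suc)
    have clm: "cl n \<in> borel_measurable borel" for n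
      by (rule borel_measurable_continuous_onI[OF clcont])
    have sqcl: "square_integrable (\<lambda>z. cl n (\<phi> z))" for n
      by (rule square_integrable_bounded[OF measurable_compose[OF meas clm] clB(1)])
    have "to_L2 (\<lambda>z. cl n (\<phi> z)) \<in> closure \<Phi>" for n
    proof (rule to_L2_closure_limit[where f = "\<lambda>k z. cl n (g k z)" and w = "\<lambda>z. real (Suc n)"])
      have cont: "continuous_on UNIV (\<lambda>z. cl n (g k z))" for k
        by (rule continuous_on_compose2[OF clcont g]) simp
      show "square_integrable (\<lambda>z. cl n (g k z))" for k by (rule square_integrable_continuous[OF cont])
      show "to_L2 (\<lambda>z. cl n (g k z)) \<in> closure \<Phi>" for k
        by (rule to_L2_bounded_continuous[OF cont clB(1)])
      show "AE z in torus. (\<lambda>k. cl n (g k z)) \<longlonglongrightarrow> cl n (\<phi> z)"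
        using AE_torus_not_negligible[OF N] AE_space
      proof eventually_elim
        case (elim z)
        then have "(\<lambda>k. g k z) \<longlonglongrightarrow> \<phi> z" using lim[of z] by (simp add: space_torus)
        moreover have "isCont (cl n) (\<phi> z)" using clcont by (simp add: continuous_on_eq_continuous_at)
        ultimately show ?case by (rule isCont_tendsto_compose[rotated])
      qed
      show "integrable torus (\<lambda>z. (real (Suc n))\<^sup>2)"
        using finite_measure_torus by (simp add: finite_measure.integrable_const)
    qed (use sqcl clB in auto)
    then have "to_L2 \<phi> \<in> closure \<Phi>"
    proof (rule to_L2_closure_limit[where f = "\<lambda>n z. cl n (\<phi> z)" and w = "\<lambda>z. cmod (\<phi> z)", rotated])
      show "AE z in torus. (\<lambda>n. cl n (\<phi> z)) \<longlonglongrightarrow> \<phi> z"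
      proof (rule AE_I2, rule tendsto_eventually)
        fix z
        have "\<forall>\<^sub>F n in sequentially. cmod (\<phi> z) \<le> real n"
          using filterlim_real_sequentially by (simp add: filterlim_at_top)
        then show "\<forall>\<^sub>F n in sequentially. cl n (\<phi> z) = \<phi> z"
          by eventually_elim (rule cleq, simp)
      qed
    qed (use sq sqcl clB in \<open>auto simp: square_integrable_def\<close>)
    then show ?thesis by (simp add: f)
  qed
  then show ?thesis by auto
qed

section \<open>The evolution on the test space\<close>

lemma norm_to_L2_le:
  assumes "square_integrable f" "\<And>z. z \<in> space torus \<Longrightarrow> cmod (f z) \<le> B" "0 \<le> B"
  shows "norm (to_L2 f) \<le> B * sqrt (measure torus (space torus))"
proof -
  have "(norm (to_L2 f))\<^sup>2 = (\<integral>z. (cmod (f z))\<^sup>2 \<partial>torus)" by (rule norm_to_L2[OF assms(1)])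
  also have "\<dots> \<le> (\<integral>z. B\<^sup>2 \<partial>torus)"
    using assms finite_measure.integrable_const[OF finite_measure_torus]
    by (intro integral_mono) (auto simp: square_integrable_def intro!: power_mono)
  also have "\<dots> = (B * sqrt (measure torus (space torus)))\<^sup>2" by (simp add: power_mult_distrib)
  finally show ?thesis by (rule power2_le_imp_le) (simp add: assms(3))
qed

lemma constraint_fun_mode_sum:
  assumes F: "F \<in> test_modes"
  shows "constraint_fun R (mode_sum F) = mode_sum (\<lambda>m y. ((of_int m)\<^sup>2 - of_real (R y)) * F m y)"
proof -
  define M where "M = {m. F m \<noteq> (\<lambda>y. 0)}"
  have M: "finite M" using F by (simp add: M_def test_modesD)
  let ?e = "\<lambda>m x. exp (\<i> * of_int m * of_real x) :: complex"
  have 1: "mode_sum F (x, y) = (\<Sum>m\<in>M. ?e m x * F m y)" for x y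
    using mode_sum_eq[OF M, of F] by (simp add: M_def)
  have 2: "mode_sum (\<lambda>m y. ((of_int m)\<^sup>2 - of_real (R y)) * F m y) (x, y) =
      (\<Sum>m\<in>M. ?e m x * (((of_int m)\<^sup>2 - of_real (R y)) * F m y))" for x y
    by (subst mode_sum_eq[OF M]) (simp_all add: M_def)
  have d: "((\<lambda>x. \<Sum>m\<in>M. ?e m x * a m) has_vector_derivative (\<Sum>m\<in>M. ?e m x * (\<i> * of_int m * a m))) (at x)" for a x
    by (intro has_vector_derivative_sum has_vector_derivative_real_field)
      (auto intro!: derivative_eq_intros)
  have 3: "nth_deriv 2 (\<lambda>s. mode_sum F (s, y)) x = (\<Sum>m\<in>M. ?e m x * (\<i> * of_int m * (\<i> * of_int m * F m y)))" for x y
    unfolding 1 numeral_2_eq_2 nth_deriv_Suc' nth_deriv_0 vector_derivative_at[OF d] ..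
  show ?thesis
  proof (rule ext, clarify)
    fix x y
    have "constraint_fun R (mode_sum F) (x, y) =
        - (\<Sum>m\<in>M. ?e m x * (\<i> * of_int m * (\<i> * of_int m * F m y))) - of_real (R y) * mode_sum F (x, y)"
      by (simp only: constraint_fun_def prod.case 3)
    also have "\<dots> = (\<Sum>m\<in>M. - (?e m x * (\<i> * of_int m * (\<i> * of_int m * F m y))) - of_real (R y) * (?e m x * F m y))"
      by (simp only: 1 sum_distrib_left sum_negf sum_subtractf)
    also have "\<dots> = mode_sum (\<lambda>m y. ((of_int m)\<^sup>2 - of_real (R y)) * F m y) (x, y)"
      unfolding 2 by (intro sum.cong refl) (simp add: algebra_simps power2_eq_square)
    finally show "constraint_fun R (mode_sum F) (x, y) = mode_sum (\<lambda>m y. ((of_int m)\<^sup>2 - of_real (R y)) * F m y) (x, y)" .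
  qed
qed

text \<open>The expected exponential of the constraint: it acts on mode \<open>m\<close> as
  multiplication by \<open>m^2 - R y\<close>, so its group is a phase. That \<open>U t\<close> has
  this form is proved in \<open>evolution_mode_sum\<close>.\<close>

definition evolved :: "(real \<Rightarrow> real) \<Rightarrow> real \<Rightarrow> (int \<Rightarrow> real \<Rightarrow> complex) \<Rightarrow> int \<Rightarrow> real \<Rightarrow> complex" where
  "evolved R t F = (\<lambda>m y. exp (- \<i> * of_real t * ((of_int m)\<^sup>2 - of_real (R y))) * F m y)"

lemma smooth_circle_of_real:
  "smooth_circle R \<Longrightarrow> smooth_circle (\<lambda>y. of_real (R y) :: complex)"
  by (auto simp: smooth_circle_iff intro: smooth_on_linear[OF bounded_linear_of_real])

lemma smooth_circle_constraint_symbol: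
  assumes "smooth_circle R"
  shows "smooth_circle (\<lambda>y. (of_int m)\<^sup>2 - of_real (R y) :: complex)"
  using smooth_circle_of_real[OF assms]
  by (auto simp: smooth_circle_iff intro: smooth_on_diff)

lemma evolved_test_modes:
  assumes "smooth_circle R" "F \<in> test_modes"
  shows "evolved R t F \<in> test_modes"
  unfolding evolved_def
proof (rule test_modes_mult[OF assms(2)])
  fix m
  have "smooth_on UNIV (\<lambda>y. exp (- \<i> * of_real t * (of_int m)\<^sup>2) * exp (\<i> * of_real t * of_real (R y)))"
    using assms(1)
    by (intro smooth_on_mult smooth_on_compose[OF open_UNIV smooth_on_exp]) (auto simp: smooth_circle_iff)
  then show "smooth_circle (\<lambda>y. exp (- \<i> * of_real t * ((of_int m)\<^sup>2 - of_real (R y))))"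
    using assms(1) by (simp add: smooth_circle_iff algebra_simps exp_diff exp_minus exp_add divide_inverse)
qed

text \<open>For imaginary \<open>w\<close> the exponential factor in the Taylor estimate is
  \<open>1\<close>, which leaves a pure quadratic bound.\<close>

lemma norm_exp_imaginary_remainder:
  fixes w :: complex
  assumes "Re w = 0"
  shows "cmod (exp w - 1 - w) \<le> (cmod w)\<^sup>2"
  using Taylor_exp[of w 1] assms by (simp add: power2_eq_square diff_diff_eq)

text \<open>The remainder is quadratic in \<open>h\<close> with a constant uniform over the torus,
  because only finitely many modes occur and each symbol is bounded on a period.\<close>

lemma evolved_has_vector_derivative_0:
  assumes R: "smooth_circle R" and F: "F \<in> test_modes"
  shows "((\<lambda>t. to_L2 (mode_sum (evolved R t F))) has_vector_derivative
    scaleC_L2 (- \<i>) (to_L2 (constraint_fun R (mode_sum F)))) (at 0)"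
proof -
  define \<Lambda> where "\<Lambda> = (\<lambda>m y. (of_int m)\<^sup>2 - of_real (R y) :: complex)"
  have \<Lambda>: "smooth_circle (\<Lambda> m)" for m
    unfolding \<Lambda>_def by (rule smooth_circle_constraint_symbol[OF R])
  define C where "C = (\<lambda>m y. \<Lambda> m y * F m y)"
  have C: "C \<in> test_modes" unfolding C_def by (rule test_modes_mult[OF F \<Lambda>])
  have CF: "constraint_fun R (mode_sum F) = mode_sum C"
    by (simp add: constraint_fun_mode_sum[OF F] C_def \<Lambda>_def)
  define M where "M = {m. F m \<noteq> (\<lambda>y. 0)}"
  have M: "finite M" using F by (simp add: M_def test_modesD)
  have F0: "F m = (\<lambda>y. 0)" if "m \<notin> M" for m using that by (simp add: M_def)
  have "\<exists>b. \<forall>y\<in>{0..2 * pi}. (cmod (\<Lambda> m y))\<^sup>2 * cmod (F m y) \<le> b" for m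
  proof -
    have "bounded ((\<lambda>y. (cmod (\<Lambda> m y))\<^sup>2 * cmod (F m y)) ` {0..2 * pi})"
      by (intro compact_imp_bounded compact_continuous_image continuous_intros
          smooth_circle_continuous \<Lambda> test_modesD F) auto
    then show ?thesis by (force simp: bounded_iff)
  qed
  then obtain b where b: "\<And>m y. y \<in> {0..2 * pi} \<Longrightarrow> (cmod (\<Lambda> m y))\<^sup>2 * cmod (F m y) \<le> b m" by metis
  have b0: "0 \<le> b m" for m
    by (rule order_trans[OF _ b[of 0 m]]) auto
  define B where "B = (\<Sum>m\<in>M. b m) * sqrt (measure torus (space torus))"
  have est: "norm (to_L2 (mode_sum (evolved R h F)) - to_L2 (mode_sum F) - h *\<^sub>R scaleC_L2 (- \<i>) (to_L2 (mode_sum C))) \<le> B * h\<^sup>2" for h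
  proof -
    let ?r = "\<lambda>m y. exp (- \<i> * of_real h * \<Lambda> m y) - 1 - (- \<i> * of_real h * \<Lambda> m y)"
    define D where "D = (\<lambda>z. mode_sum (evolved R h F) z - mode_sum F z - (of_real h * (- \<i>)) * mode_sum C z)"
    have sq: "square_integrable (mode_sum (evolved R h F))" "square_integrable (mode_sum F)" "square_integrable (mode_sum C)"
      by (intro square_integrable_mode_sum evolved_test_modes R F C)+
    have sqd: "square_integrable (\<lambda>z. mode_sum (evolved R h F) z - mode_sum F z)"
      using square_integrable_add[OF sq(1) square_integrable_scale[OF sq(2), of "-1"]] by simp
    have sqD: "square_integrable D" unfolding D_def
      using square_integrable_add[OF sqd square_integrable_scale[OF sq(3), of "- (of_real h * (- \<i>))"]] by simp
    have "to_L2 (mode_sum (evolved R h F)) - to_L2 (mode_sum F) - h *\<^sub>R scaleC_L2 (- \<i>) (to_L2 (mode_sum C)) = to_L2 D"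
      unfolding scaleR_L2_torus_def cL2.scale_scale
      unfolding to_L2_scaleC[OF sq(3)] to_L2_diff[OF sq(1,2)]
        to_L2_diff[OF sqd square_integrable_scale[OF sq(3)]] D_def ..
    moreover have "cmod (D z) \<le> h\<^sup>2 * (\<Sum>m\<in>M. b m)" if zt: "z \<in> space torus" for z
    proof -
      obtain x y where z: "z = (x, y)" "y \<in> {0..2 * pi}" using zt by (auto simp: space_torus)
      let ?e = "\<lambda>m. exp (\<i> * of_int m * of_real x) :: complex"
      have "mode_sum (evolved R h F) z = (\<Sum>m\<in>M. ?e m * evolved R h F m y)"
        "mode_sum F z = (\<Sum>m\<in>M. ?e m * F m y)" "mode_sum C z = (\<Sum>m\<in>M. ?e m * C m y)"
        unfolding z
        by (subst mode_sum_eq[OF M]; simp add: F0 evolved_def C_def)+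
      then have "D z = (\<Sum>m\<in>M. ?e m * (?r m y * F m y))"
        by (simp add: D_def sum_distrib_left sum_subtractf[symmetric] evolved_def C_def \<Lambda>_def algebra_simps sum.distrib[symmetric])
      also have "cmod \<dots> \<le> (\<Sum>m\<in>M. h\<^sup>2 * b m)"
      proof (rule sum_norm_le)
        fix m
        let ?w = "- \<i> * of_real h * \<Lambda> m y"
        have "Re ?w = 0" by (simp add: \<Lambda>_def power2_eq_square)
        then have "cmod (?r m y) \<le> (cmod ?w)\<^sup>2"
          by (rule norm_exp_imaginary_remainder)
        also have "\<dots> = h\<^sup>2 * (cmod (\<Lambda> m y))\<^sup>2" by (simp add: norm_mult power_mult_distrib)
        finally have "cmod (?r m y) * cmod (F m y) \<le> h\<^sup>2 * (cmod (\<Lambda> m y))\<^sup>2 * cmod (F m y)"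
          by (rule mult_right_mono) simp
        also have "\<dots> \<le> h\<^sup>2 * b m"
          unfolding mult.assoc by (intro mult_left_mono b z) simp
        finally show "cmod (?e m * (?r m y * F m y)) \<le> h\<^sup>2 * b m" by (simp only: norm_mult norm_exp_imaginary) simp
      qed
      finally show ?thesis by (simp add: sum_distrib_left)
    qed
    ultimately show ?thesis
      using norm_to_L2_le[OF sqD, of "h\<^sup>2 * (\<Sum>m\<in>M. b m)"] b0
      by (simp add: B_def sum_nonneg mult_ac)
  qed
  have lim: "((\<lambda>h. B * \<bar>h\<bar>) \<longlongrightarrow> 0) (at (0::real))"
    by (rule tendsto_eq_intros | simp)+
  have ev0: "evolved R 0 F = F" by (simp add: evolved_def)
  show ?thesis
    unfolding CF has_vector_derivative_def has_derivative_at
  proof (intro conjI bounded_linear_scaleR_left)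
    show "(\<lambda>h. norm (to_L2 (mode_sum (evolved R (0 + h) F)) - to_L2 (mode_sum (evolved R 0 F)) -
        h *\<^sub>R scaleC_L2 (- \<i>) (to_L2 (mode_sum C))) / norm h) \<midarrow>0\<rightarrow> 0"
    proof (rule Lim_null_comparison[OF _ lim], rule always_eventually, rule allI)
      fix h :: real
      show "norm (norm (to_L2 (mode_sum (evolved R (0 + h) F)) - to_L2 (mode_sum (evolved R 0 F)) -
        h *\<^sub>R scaleC_L2 (- \<i>) (to_L2 (mode_sum C))) / norm h) \<le> B * \<bar>h\<bar>"
        using est[of h] by (cases "h = 0") (simp_all add: ev0 divide_le_eq power2_eq_square mult.assoc)
    qed
  qed
qed

lemma evolution_mode_sum:
  assumes R: "smooth_circle R" and U: "constraint_evolution R U" and F: "F \<in> test_modes"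
  shows "U t (to_L2 (mode_sum F)) = to_L2 (mode_sum (evolved R t F))"
proof -
  have gen: "generated_by U (closure (constraint_graph R))"
    using U by (simp add: constraint_evolution_def)
  then have U0: "U 0 = id" and Uadd: "U (s + t) = U s \<circ> U t" and lin: "Vector_Spaces.linear scaleC_L2 scaleC_L2 (U t)"
    and iso: "cinner_L2 (U t f) (U t g) = cinner_L2 f g" for s t f g
    by (auto simp: generated_by_def unitary_group_def unitary_L2_def)
  have Udiff: "U t f - U t g = U t (f - g)" for t f g
  proof -
    interpret W: Vector_Spaces.linear scaleC_L2 scaleC_L2 "U t" by (rule lin)
    show ?thesis by (simp add: W.diff)
  qed
  have Unorm: "norm (U t f) = norm f" for t f
    by (simp add: norm_eq_sqrt_inner inner_L2_torus_def iso)
  have der: "((\<lambda>t. U t (to_L2 (mode_sum G))) has_vector_derivative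
      scaleC_L2 (- \<i>) (to_L2 (constraint_fun R (mode_sum G)))) (at 0)" if "G \<in> test_modes" for G
  proof -
    have "(to_L2 (mode_sum G), to_L2 (constraint_fun R (mode_sum G))) \<in> closure (constraint_graph R)"
      using that closure_subset[of "constraint_graph R"] by (auto simp: constraint_graph_def)
    then show ?thesis using gen by (auto simp: generated_by_def)
  qed
  \<comment> \<open>Uniqueness in Stone's theorem: \<open>U (- t)\<close> applied to the explicit solution has derivative \<open>0\<close>.\<close>
  define \<psi> where "\<psi> = (\<lambda>t. to_L2 (mode_sum (evolved R t F)))"
  define g where "g = (\<lambda>t. U (- t) (\<psi> t))"
  have "(g has_derivative (\<lambda>h. 0)) (at t)" for t
  proof -
    define G where "G = evolved R t F"
    have G: "G \<in> test_modes" unfolding G_def by (rule evolved_test_modes[OF R F])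
    have "((\<lambda>h. to_L2 (mode_sum (evolved R h G)) - U h (to_L2 (mode_sum G))) has_vector_derivative 0) (at 0)"
      using has_vector_derivative_diff[OF evolved_has_vector_derivative_0[OF R G] der[OF G]] by simp
    moreover have "evolved R 0 G = G" by (simp add: evolved_def)
    ultimately have lim: "(\<lambda>h. norm (to_L2 (mode_sum (evolved R h G)) - U h (to_L2 (mode_sum G))) / norm h) \<midarrow>0\<rightarrow> 0"
      by (simp add: has_vector_derivative_def has_derivative_at U0)
    \<comment> \<open>Pulling out the isometry \<open>U (- (t + h))\<close> turns the increment of
      \<open>g\<close> at \<open>t\<close> into the gap between the two evolutions of
      \<open>G\<close> after time \<open>h\<close>. Only derivatives at time \<open>0\<close> are
      then required.\<close>
    have "norm (g (t + h) - g t) = norm (to_L2 (mode_sum (evolved R h G)) - U h (to_L2 (mode_sum G)))" for h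
    proof -
      have "evolved R (t + h) F = evolved R h G"
        by (simp add: evolved_def G_def fun_eq_iff algebra_simps flip: exp_add)
      then have "g (t + h) = U (- (t + h)) (to_L2 (mode_sum (evolved R h G)))" by (simp add: g_def \<psi>_def)
      moreover have "g t = U (- (t + h)) (U h (to_L2 (mode_sum G)))"
        using Uadd[of "- (t + h)" h] by (simp add: g_def \<psi>_def G_def)
      ultimately show ?thesis by (simp only: Udiff Unorm)
    qed
    with lim show ?thesis by (simp add: has_derivative_at)
  qed
  then have "\<exists>c. \<forall>t\<in>UNIV. g t = c"
    by (intro has_derivative_zero_constant) auto
  then have "g t = g 0" by auto
  also have "g 0 = to_L2 (mode_sum F)" by (simp add: g_def \<psi>_def U0 evolved_def)
  finally have "U (- t) (\<psi> t) = to_L2 (mode_sum F)" by (simp add: g_def)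
  moreover have "U t (U (- t) (\<psi> t)) = \<psi> t" using Uadd[of t "- t"] by (simp add: U0 fun_eq_iff)
  ultimately show ?thesis by (simp add: \<psi>_def)
qed

section \<open>Observables connecting two solutions\<close>

definition single_mode :: "int \<Rightarrow> (real \<Rightarrow> complex) \<Rightarrow> int \<Rightarrow> real \<Rightarrow> complex" where
  "single_mode n f = (\<lambda>k. if k = n then f else (\<lambda>y. 0))"

lemma single_mode_test_modes: "smooth_circle f \<Longrightarrow> single_mode n f \<in> test_modes"
  by (rule test_modesI[of _ "{n}"]) (auto simp: single_mode_def smooth_circle_0)

lemma cinner_single_mode_right:
  assumes "G \<in> test_modes" "smooth_circle f"
  shows "cinner_L2 (to_L2 (mode_sum G)) (to_L2 (mode_sum (single_mode n f))) =
    2 * of_real pi * integral {0..2 * pi} (\<lambda>y. cnj (G n y) * f y)"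
proof -
  \<comment> \<open>\<open>n\<close> is inserted for the case that \<open>G n\<close> vanishes
    identically.\<close>
  define M where "M = insert n {m. G m \<noteq> (\<lambda>y. 0)}"
  have M: "finite M" "n \<in> M" using assms(1) by (auto simp: M_def test_modesD)
  have "(\<Sum>m\<in>M. integral {0..2 * pi} (\<lambda>y. cnj (G m y) * single_mode n f m y)) =
      (\<Sum>m\<in>M. if m = n then integral {0..2 * pi} (\<lambda>y. cnj (G n y) * f y) else 0)"
    by (intro sum.cong refl) (simp add: single_mode_def)
  then show ?thesis
    by (subst cinner_modes[OF assms(1) single_mode_test_modes[OF assms(2)] M(1)])
      (use M in \<open>auto simp: M_def single_mode_def\<close>)
qed

lemma cinner_single_mode_left:
  assumes "G \<in> test_modes" "smooth_circle f"
  shows "cinner_L2 (to_L2 (mode_sum (single_mode n f))) (to_L2 (mode_sum G)) =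
    2 * of_real pi * integral {0..2 * pi} (\<lambda>y. cnj (f y) * G n y)"
proof -
  define M where "M = insert n {m. G m \<noteq> (\<lambda>y. 0)}"
  have M: "finite M" "n \<in> M" using assms(1) by (auto simp: M_def test_modesD)
  have "(\<Sum>m\<in>M. integral {0..2 * pi} (\<lambda>y. cnj (single_mode n f m y) * G m y)) =
      (\<Sum>m\<in>M. if m = n then integral {0..2 * pi} (\<lambda>y. cnj (f y) * G n y) else 0)"
    by (intro sum.cong refl) (simp add: single_mode_def)
  then show ?thesis
    by (subst cinner_modes[OF single_mode_test_modes[OF assms(2)] assms(1) M(1)])
      (use M in \<open>auto simp: M_def single_mode_def\<close>)
qed

text \<open>
  With charts at \<open>y0\<close> (for \<open>R y = n\<^sup>2\<close>) and \<open>z0\<close> (for \<open>R z = m\<^sup>2\<close>), this operator moves the \<open>m\<close>-th mode near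
  \<open>z0\<close> to the \<open>n\<close>-th mode near \<open>y0\<close> by matching the coordinates \<open>s\<close>.  Matched points satisfy
  \<open>n\<^sup>2 - R y = m\<^sup>2 - R z\<close>, whence it commutes with the evolution.
\<close>

definition transfer_op ::
  "(real \<Rightarrow> real) \<Rightarrow> nat \<Rightarrow> int \<Rightarrow> (real \<Rightarrow> real) \<Rightarrow> int \<Rightarrow> ((real \<Rightarrow> complex) \<Rightarrow> real \<Rightarrow> complex) \<Rightarrow>
    L2_torus \<Rightarrow> L2_torus" where
  "transfer_op R p n \<rho> m X f = to_L2 (mode_sum (single_mode n
     (\<lambda>y. \<rho> y *\<^sub>R X (modes f m) (root p (R y - (of_int n)\<^sup>2)))))"

section \<open>The test space as a dense complex subspace\<close>

lemma test_space_cases: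
  assumes "f \<in> \<Phi>"
  obtains F where "F \<in> test_modes" "f = to_L2 (mode_sum F)" "modes f = F"
  using assms modes_mode_sum by (auto simp: test_space_def)

lemma to_L2_mode_sum_test_space: "F \<in> test_modes \<Longrightarrow> to_L2 (mode_sum F) \<in> \<Phi>"
  by (simp add: test_space_def)

text \<open>By density, two candidates for the value of an adjoint coincide. The real inner product
  suffices, since the difference \<open>k - k'\<close> is in the end tested against itself.\<close>

lemma cinner_test_space_determines:
  assumes "\<And>f. f \<in> \<Phi> \<Longrightarrow> cinner_L2 k f = cinner_L2 k' f"
  shows "k = k'"
proof -
  have "k \<bullet> f = k' \<bullet> f" if "f \<in> \<Phi>" for f
    using assms[OF that] by (simp add: inner_L2_torus_def)
  then have "\<Phi> \<subseteq> {f. (k - k') \<bullet> f = 0}"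
    by (auto simp: inner_diff_left)
  moreover have "closed {f. (k - k') \<bullet> f = 0}"
    by (intro closed_Collect_eq continuous_intros)
  ultimately have "closure \<Phi> \<subseteq> {f. (k - k') \<bullet> f = 0}" by (rule closure_minimal)
  then have "(k - k') \<bullet> (k - k') = 0" using closure_test_space by blast
  then show ?thesis by simp
qed

lemma test_space_add:
  assumes "f \<in> \<Phi>" "g \<in> \<Phi>"
  shows "f + g \<in> \<Phi>" "modes (f + g) m = (\<lambda>y. modes f m y + modes g m y)"
proof -
  obtain F where F: "F \<in> test_modes" "f = to_L2 (mode_sum F)" "modes f = F"
    using assms(1) by (rule test_space_cases)
  obtain G where G: "G \<in> test_modes" "g = to_L2 (mode_sum G)" "modes g = G"
    using assms(2) by (rule test_space_cases)
  note FG = test_modes_add[OF F(1) G(1)]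
  have "f + g = to_L2 (mode_sum (\<lambda>m y. F m y + G m y))"
    unfolding F(2) G(2) FG(2) by (intro to_L2_add square_integrable_mode_sum F G)
  then show "f + g \<in> \<Phi>" "modes (f + g) m = (\<lambda>y. modes f m y + modes g m y)"
    using FG(1) by (simp_all add: to_L2_mode_sum_test_space modes_mode_sum F(3) G(3))
qed

lemma test_space_scale:
  assumes "f \<in> \<Phi>"
  shows "scaleC_L2 c f \<in> \<Phi>" "modes (scaleC_L2 c f) m = (\<lambda>y. c * modes f m y)"
proof -
  obtain F where F: "F \<in> test_modes" "f = to_L2 (mode_sum F)" "modes f = F"
    using assms(1) by (rule test_space_cases)
  have cF: "(\<lambda>m y. c * F m y) \<in> test_modes"
    by (rule test_modes_mult[OF F(1) smooth_circle_const])
  have "scaleC_L2 c f = to_L2 (mode_sum (\<lambda>m y. c * F m y))"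
    unfolding F(2) mode_sum_scale[OF F(1)] by (intro to_L2_scaleC square_integrable_mode_sum F)
  then show "scaleC_L2 c f \<in> \<Phi>" "modes (scaleC_L2 c f) m = (\<lambda>y. c * modes f m y)"
    using cF by (simp_all add: to_L2_mode_sum_test_space modes_mode_sum F(3))
qed

lemma subspace_test_space: "cL2.subspace \<Phi>"
proof -
  have "(\<lambda>m y. 0) \<in> test_modes" by (rule test_modesI[of _ "{}"]) (auto simp: smooth_circle_0)
  then have "to_L2 (mode_sum (\<lambda>m y. 0)) \<in> \<Phi>" by (rule to_L2_mode_sum_test_space)
  moreover have "mode_sum (\<lambda>m y. 0) = (\<lambda>z. 0)" by (simp add: mode_sum_def fun_eq_iff)
  ultimately show ?thesis
    by (auto simp: cL2.subspace_def zero_L2_torus_def test_space_add test_space_scale)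
qed

text \<open>The operator reads through \<open>X'\<close> of the source and writes through
  \<open>\<rho>\<close> of the target. The remaining data, \<open>X\<close> and
  \<open>\<rho>'\<close>, are those of the operator in the opposite direction, so exchanging the
  charts describes its adjoint.\<close>

locale chart_pair =
  target: level_chart R "(of_int n)\<^sup>2" p y0 Z \<rho> X + source: level_chart R "(of_int m)\<^sup>2" p z0 Z' \<rho>' X'
  for R p n y0 Z \<rho> X m z0 Z' \<rho>' X'
begin

abbreviation "T \<equiv> transfer_op R p n \<rho> m X'"

lemma transfer_mode_sum:
  assumes "F \<in> test_modes"
  shows "smooth_circle (\<lambda>y. \<rho> y *\<^sub>R X' (F m) (root p (R y - (of_int n)\<^sup>2)))"
    "T (to_L2 (mode_sum F)) =
      to_L2 (mode_sum (single_mode n (\<lambda>y. \<rho> y *\<^sub>R X' (F m) (root p (R y - (of_int n)\<^sup>2)))))"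
  using assms
  by (auto simp: transfer_op_def modes_mode_sum intro: target.smooth_pullback source.smooth_transfer test_modesD)

lemma T_test_space: "f \<in> \<Phi> \<Longrightarrow> T f \<in> \<Phi>"
  by (elim test_space_cases)
    (simp add: transfer_mode_sum to_L2_mode_sum_test_space single_mode_test_modes)

text \<open>On the \<open>s\<close> line the pairing treats both charts alike. Its value coincides
  with that of \<open>cinner_transfer_left\<close> for the exchanged pair, and this is the adjoint
  relation.\<close>

lemma cinner_transfer:
  assumes "F \<in> test_modes" "G \<in> test_modes"
  shows "cinner_L2 (to_L2 (mode_sum G)) (T (to_L2 (mode_sum F))) =
    2 * of_real pi * integral UNIV (\<lambda>s. cnj (X (G n) s) * X' (F m) s)"
  using assms
  by (simp add: transfer_mode_sum cinner_single_mode_right target.integral_transfer test_modesD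
      source.smooth_transfer del: mult_scaleR_right)

lemma cinner_transfer_left:
  assumes "F \<in> test_modes" "G \<in> test_modes"
  shows "cinner_L2 (T (to_L2 (mode_sum F))) (to_L2 (mode_sum G)) =
    2 * of_real pi * integral UNIV (\<lambda>s. cnj (X' (F m) s) * X (G n) s)"
proof -
  let ?f = "\<lambda>y. \<rho> y *\<^sub>R X' (F m) (root p (R y - (of_int n)\<^sup>2))"
  have "cinner_L2 (T (to_L2 (mode_sum F))) (to_L2 (mode_sum G)) =
      2 * of_real pi * integral {0..2 * pi} (\<lambda>y. cnj (?f y) * G n y)"
    using assms by (simp add: transfer_mode_sum cinner_single_mode_left)
  also have "integral {0..2 * pi} (\<lambda>y. cnj (?f y) * G n y) = cnj (integral {0..2 * pi} (\<lambda>y. cnj (G n y) * ?f y))"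
    by (simp add: Henstock_Kurzweil_Integration.integral_cnj mult.commute)
  also have "\<dots> = cnj (integral UNIV (\<lambda>s. cnj (X (G n) s) * X' (F m) s))"
    using assms by (simp add: target.integral_transfer test_modesD source.smooth_transfer del: mult_scaleR_right)
  also have "\<dots> = integral UNIV (\<lambda>s. cnj (X' (F m) s) * X (G n) s)"
    by (simp add: Henstock_Kurzweil_Integration.integral_cnj mult.commute)
  finally show ?thesis .
qed

lemma T_add:
  assumes "f \<in> \<Phi>" "g \<in> \<Phi>"
  shows "T (f + g) = T f + T g"
proof -
  obtain F where F: "F \<in> test_modes" "f = to_L2 (mode_sum F)" "modes f = F"
    using assms(1) by (rule test_space_cases)
  obtain G where G: "G \<in> test_modes" "g = to_L2 (mode_sum G)" "modes g = G"
    using assms(2) by (rule test_space_cases)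
  note FG = transfer_mode_sum(1)[OF F(1)] transfer_mode_sum(1)[OF G(1)]
  note sFG = FG[THEN single_mode_test_modes[of _ n]]
  have "T f + T g = to_L2 (mode_sum (\<lambda>k y.
      single_mode n (\<lambda>y. \<rho> y *\<^sub>R X' (F m) (root p (R y - (of_int n)\<^sup>2))) k y +
      single_mode n (\<lambda>y. \<rho> y *\<^sub>R X' (G m) (root p (R y - (of_int n)\<^sup>2))) k y))"
    unfolding F(2) G(2) transfer_mode_sum(2)[OF F(1)] transfer_mode_sum(2)[OF G(1)] test_modes_add(2)[OF sFG]
    by (intro to_L2_add square_integrable_mode_sum sFG)
  also have "\<dots> = T (f + g)"
    unfolding transfer_op_def test_space_add(2)[OF assms] F(3) G(3) source.transfer_add
    by (intro arg_cong[of _ _ "\<lambda>F. to_L2 (mode_sum F)"]) (auto simp: single_mode_def fun_eq_iff scaleR_add_right)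
  finally show ?thesis ..
qed

lemma T_scale:
  assumes "f \<in> \<Phi>"
  shows "T (scaleC_L2 c f) = scaleC_L2 c (T f)"
proof -
  obtain F where F: "F \<in> test_modes" "f = to_L2 (mode_sum F)" "modes f = F"
    using assms(1) by (rule test_space_cases)
  note sF = single_mode_test_modes[OF transfer_mode_sum(1)[OF F(1)], of n]
  have "scaleC_L2 c (T f) = to_L2 (mode_sum (\<lambda>k y. c *
      single_mode n (\<lambda>y. \<rho> y *\<^sub>R X' (F m) (root p (R y - (of_int n)\<^sup>2))) k y))"
    unfolding F(2) transfer_mode_sum(2)[OF F(1)] mode_sum_scale[OF sF]
    by (intro to_L2_scaleC square_integrable_mode_sum sF)
  also have "\<dots> = T (scaleC_L2 c f)"
    \<comment> \<open>Homogeneity of \<open>X'\<close> is its multiplicativity for a constant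
      weight.\<close>
    unfolding transfer_op_def test_space_scale(2)[OF assms] F(3) source.transfer_mult[of "\<lambda>r. c"]
    by (intro arg_cong[of _ _ "\<lambda>F. to_L2 (mode_sum F)"]) (auto simp: single_mode_def fun_eq_iff)
  finally show ?thesis ..
qed

lemma T_commutes:
  assumes R: "smooth_circle R" and U: "constraint_evolution R U" and "f \<in> \<Phi>"
  shows "T (U t f) = U t (T f)"
proof -
  obtain F where F: "F \<in> test_modes" "f = to_L2 (mode_sum F)" "modes f = F"
    using assms(3) by (rule test_space_cases)
  note eF = evolved_test_modes[OF R F(1), of t]
  let ?u = "\<lambda>y. root p (R y - (of_int n)\<^sup>2)"
  let ?w = "\<lambda>r. exp (- \<i> * of_real t * ((of_int m)\<^sup>2 - of_real r))"
  have "T (U t f) = to_L2 (mode_sum (single_mode n (\<lambda>y. \<rho> y *\<^sub>R X' (evolved R t F m) (?u y))))"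
    unfolding F(2) evolution_mode_sum[OF R U F(1)] by (rule transfer_mode_sum(2)[OF eF])
  also have "(\<lambda>y. \<rho> y *\<^sub>R X' (evolved R t F m) (?u y)) =
      (\<lambda>y. exp (- \<i> * of_real t * ((of_int n)\<^sup>2 - of_real (R y))) * (\<rho> y *\<^sub>R X' (F m) (?u y)))"
  proof
    fix y
    \<comment> \<open>\<open>X'\<close> evaluates the weight at \<open>m^2 + s ^ p\<close>, and the
      odd root undoes the power for either sign. The phase of mode \<open>m\<close> thus becomes
      that of mode \<open>n\<close> at \<open>y\<close>.\<close>
    have "(of_int m)\<^sup>2 + ?u y ^ p = (of_int m)\<^sup>2 + (R y - (of_int n)\<^sup>2)"
      using source.odd_p by (simp add: odd_real_root_pow)
    then have "X' (evolved R t F m) (?u y) = ?w ((of_int m)\<^sup>2 + (R y - (of_int n)\<^sup>2)) * X' (F m) (?u y)"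
      unfolding evolved_def by (simp only: source.transfer_mult[of ?w])
    then show "\<rho> y *\<^sub>R X' (evolved R t F m) (?u y) =
        exp (- \<i> * of_real t * ((of_int n)\<^sup>2 - of_real (R y))) * (\<rho> y *\<^sub>R X' (F m) (?u y))"
      by (simp add: algebra_simps)
  qed
  also have "single_mode n \<dots> = evolved R t (single_mode n (\<lambda>y. \<rho> y *\<^sub>R X' (F m) (?u y)))"
    by (auto simp: single_mode_def evolved_def fun_eq_iff)
  also have "to_L2 (mode_sum \<dots>) = U t (T f)"
    unfolding F(2) transfer_mode_sum(2)[OF F(1)]
    by (rule evolution_mode_sum[OF R U single_mode_test_modes[OF transfer_mode_sum(1)[OF F(1)]], symmetric])
  finally show ?thesis .
qed

end

lemma (in chart_pair) transfer_observable:
  assumes R: "smooth_circle R" and U: "constraint_evolution R U"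
  shows "(\<Phi>, T) \<in> observables U"
proof -
  interpret rev: chart_pair R p m z0 Z' \<rho>' X' n y0 Z \<rho> X ..
  have adj: "cinner_L2 h (T f) = cinner_L2 (rev.T h) f" if "h \<in> \<Phi>" "f \<in> \<Phi>" for h f
    using that by (elim test_space_cases) (simp add: cinner_transfer rev.cinner_transfer_left)
  have "snd (adjoint_op (\<Phi>, T)) h = rev.T h" if "h \<in> \<Phi>" for h
    unfolding adjoint_op_def prod.case snd_conv
    \<comment> \<open>Existence is the adjoint relation \<open>adj\<close>; uniqueness is density of
      the test space.\<close>
    by (rule the_equality) (auto simp: adj that intro: cinner_test_space_determines)
  moreover have "\<Phi> \<subseteq> fst (adjoint_op (\<Phi>, T))" using adj by (auto simp: adjoint_op_def)
  moreover have "densely_defined_operator (\<Phi>, T)"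
    by (simp add: densely_defined_operator_def subspace_test_space closure_test_space T_add T_scale)
  ultimately show ?thesis
    by (auto simp: observables_def T_test_space rev.T_test_space T_commutes[OF R U])
qed

section \<open>Evaluation functionals and the invariant subspace\<close>

definition evaluation :: "int \<Rightarrow> real \<Rightarrow> L2_torus \<Rightarrow> complex" where
  "evaluation n y = (\<lambda>g. if g \<in> \<Phi> then modes g n y else 0)"

lemma sum_fun_apply: "(\<Sum>a\<in>A. f a) x = (\<Sum>a\<in>A. f a x)"
  by (induction A rule: infinite_finite_induct) auto

text \<open>Evaluations vanish off \<Phi>, as \<open>eta\<close> does, so the identity holds between
  functions on the whole space. Written as a sum of functions, it lets the subspace rules act term
  by term.\<close>

lemma eta_eq_sum:
  "eta R p f = (\<Sum>m | modes f m \<noteq> (\<lambda>y. 0). \<Sum>y\<in>solutions R p (nat \<bar>m\<bar>).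
    (\<lambda>g. (of_real ((2 * pi)\<^sup>2) * cnj (modes f m y) / of_real (\<bar>nth_deriv p R y\<bar> powr (1 / real p))) * evaluation m y g))"
  by (simp add: eta_def evaluation_def fun_eq_iff sum_fun_apply sum_distrib_left mult_ac)

lemma solutions_order:
  assumes adm: "admissible_potential R" and y: "y \<in> solutions R p q"
  shows "R y = (real q)\<^sup>2" "y \<in> {0..<2 * pi}" "nth_deriv p R y \<noteq> 0"
    "\<And>k. 1 \<le> k \<Longrightarrow> k < p \<Longrightarrow> nth_deriv k R y = 0"
proof -
  \<comment> \<open>A least number is informative only if some candidate exists: the first
    derivative, or at a stationary point the one that admissibility provides.\<close>
  have "\<exists>n. 1 \<le> n \<and> nth_deriv n R y \<noteq> 0"
    using adm by (cases "nth_deriv 1 R y = 0") (auto simp: admissible_potential_def)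
  from LeastI_ex[OF this] show "nth_deriv p R y \<noteq> 0"
    using y by (auto simp: solutions_def point_order_def)
  show "nth_deriv k R y = 0" if "1 \<le> k" "k < p" for k
    using y that not_less_Least[of k "\<lambda>n. 1 \<le> n \<and> nth_deriv n R y \<noteq> 0"]
    by (auto simp: solutions_def point_order_def)
qed (use y in \<open>auto simp: solutions_def\<close>)

theorem propositionC1:
  fixes R :: "real \<Rightarrow> real" and U :: "real \<Rightarrow> L2_torus \<Rightarrow> L2_torus"
    and p :: nat and V :: "(L2_torus \<Rightarrow> complex) set"
  assumes "admissible_potential R"
    and "constraint_evolution R U"
    and "p \<in> orders R" and "odd p"
    and "V \<subseteq> H_RAQ R p" and "functionals.subspace V"
    and "observable_invariant R U p V"
    and "V \<noteq> {0}"
  shows "V = H_RAQ R p"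
proof
  have R: "smooth_circle R" using assms(1) by (simp add: admissible_potential_def)
  \<comment> \<open>The excluded set consists of the other solutions at the same level, so that the
    cutoff isolates \<open>y\<close> among them.\<close>
  have chart: "\<exists>\<rho> X. level_chart R ((of_int n)\<^sup>2) p y (solutions R p (nat \<bar>n\<bar>) - {y}) \<rho> X"
    if "finite (solutions R p (nat \<bar>n\<bar>))" "y \<in> solutions R p (nat \<bar>n\<bar>)" for n :: int and y
  proof -
    note y = solutions_order[OF assms(1) that(2)]
    have "R y = (of_int n)\<^sup>2" using y(1) by simp
    moreover have "solutions R p (nat \<bar>n\<bar>) - {y} \<subseteq> {0..<2 * pi}" by (auto simp: solutions_def)
    ultimately show ?thesis
      using level_chart_exists[OF R assms(4) _ y(4,3), of "(of_int n)\<^sup>2" "solutions R p (nat \<bar>n\<bar>) - {y}"]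
        that(1) y(2) by blast
  qed
  have V0: "0 \<in> V" using assms(6) by (rule functionals.subspace_0)
  then obtain \<xi> where \<xi>: "\<xi> \<in> V" "\<xi> \<noteq> 0" using assms(8) by auto
  then obtain \<phi> where \<phi>: "\<phi> \<in> \<Phi>" "\<xi> = eta R p \<phi>" using assms(5) by (auto simp: H_RAQ_def)
  obtain F where F: "F \<in> test_modes" "\<phi> = to_L2 (mode_sum F)" "modes \<phi> = F"
    using \<phi>(1) by (rule test_space_cases)
  \<comment> \<open>A sum over an infinite solution set would be \<open>0\<close>, so only finite ones matter and finiteness need not be proved.\<close>
  have "\<exists>m z. finite (solutions R p (nat \<bar>m\<bar>)) \<and> z \<in> solutions R p (nat \<bar>m\<bar>) \<and> F m z \<noteq> 0"
  proof (rule ccontr)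
    assume no: "\<not> ?thesis"
    have "(\<Sum>y\<in>solutions R p (nat \<bar>m\<bar>).
      (\<lambda>g. (of_real ((2 * pi)\<^sup>2) * cnj (F m y) / of_real (\<bar>nth_deriv p R y\<bar> powr (1 / real p))) * evaluation m y g)) = 0" for m
    proof (cases "finite (solutions R p (nat \<bar>m\<bar>))")
      case True
      then show ?thesis using no by (intro sum.neutral) (auto simp: fun_eq_iff)
    qed simp
    then have "\<xi> = 0" unfolding \<phi>(2) eta_eq_sum F(3) by simp
    with \<xi>(2) show False ..
  qed
  then obtain m z where m: "finite (solutions R p (nat \<bar>m\<bar>))" "z \<in> solutions R p (nat \<bar>m\<bar>)" "F m z \<noteq> 0"
    by blast
  obtain \<rho>' X' where src: "level_chart R ((of_int m)\<^sup>2) p z (solutions R p (nat \<bar>m\<bar>) - {z}) \<rho>' X'"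
    using chart[OF m(1,2)] by blast
  \<comment> \<open>The source \<open>(m, z)\<close> stays fixed while the target ranges over all
    pairs, so one nonvanishing value of \<open>F\<close> is enough.\<close>
  have ev: "evaluation n y \<in> V"
    if fin: "finite (solutions R p (nat \<bar>n\<bar>))" and y: "y \<in> solutions R p (nat \<bar>n\<bar>)" for n y
  proof -
    obtain \<rho> X where tgt: "level_chart R ((of_int n)\<^sup>2) p y (solutions R p (nat \<bar>n\<bar>) - {y}) \<rho> X"
      using chart[OF fin y] by blast
    interpret chart_pair R p n y "solutions R p (nat \<bar>n\<bar>) - {y}" \<rho> X m z "solutions R p (nat \<bar>m\<bar>) - {z}" \<rho>' X'
      unfolding chart_pair_def using tgt src by blast
    define h where "h = (\<lambda>y. \<rho> y *\<^sub>R X' (F m) (root p (R y - (of_int n)\<^sup>2)))"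
    have h: "smooth_circle h" unfolding h_def by (rule transfer_mode_sum(1)[OF F(1)])
    have modesT: "modes (T \<phi>) = single_mode n h"
      unfolding F(2) transfer_mode_sum(2)[OF F(1)] h_def[symmetric]
      by (rule modes_mode_sum[OF single_mode_test_modes[OF h]])
    have "eta R p (T \<phi>) \<in> V"
      using assms(7) transfer_observable[OF R assms(2)] \<phi> \<xi>(1) by (auto simp: observable_invariant_def)
    define c where "c = of_real ((2 * pi)\<^sup>2) * cnj (h y) / of_real (\<bar>nth_deriv p R y\<bar> powr (1 / real p))"
    have Ry: "R y = (of_int n)\<^sup>2" using solutions_order(1)[OF assms(1) y] by simp
    \<comment> \<open>Both \<open>y\<close> and \<open>z\<close> have coordinate
      \<open>s = 0\<close>, so \<open>h y\<close> is the cutoff at \<open>y\<close> times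
      \<open>X' (F m) 0\<close>, which is nonzero because \<open>F m z\<close> is.\<close>
    have "h y \<noteq> 0"
      using target.cutoff_nonzero source.transfer_0[of "F m"] m(3) by (simp add: h_def Ry)
    then have c0: "c \<noteq> 0" using solutions_order(3)[OF assms(1) y] by (simp add: c_def)
    have hz: "h z = 0" if "z \<in> solutions R p (nat \<bar>n\<bar>) - {y}" for z
      using target.cutoff_zero[OF that] by (simp add: h_def)
    have "{k. single_mode n h k \<noteq> (\<lambda>y. 0)} = {n}"
      using \<open>h y \<noteq> 0\<close> by (auto simp: single_mode_def fun_eq_iff)
    then have "eta R p (T \<phi>) = (\<Sum>z\<in>solutions R p (nat \<bar>n\<bar>).
      (\<lambda>g. (of_real ((2 * pi)\<^sup>2) * cnj (h z) / of_real (\<bar>nth_deriv p R z\<bar> powr (1 / real p))) * evaluation n z g))"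
      unfolding eta_eq_sum modesT by (simp add: single_mode_def)
    also have "\<dots> = (\<Sum>z\<in>{y}.
      (\<lambda>g. (of_real ((2 * pi)\<^sup>2) * cnj (h z) / of_real (\<bar>nth_deriv p R z\<bar> powr (1 / real p))) * evaluation n z g))"
      by (rule sum.mono_neutral_right[OF fin]) (use y hz in \<open>auto simp: fun_eq_iff\<close>)
    finally have "(\<lambda>g. c * evaluation n y g) \<in> V" using \<open>eta R p (T \<phi>) \<in> V\<close> by (simp add: c_def)
    \<comment> \<open>\<open>V\<close> contains a nonzero multiple of the evaluation; complex
      linearity of \<open>V\<close> removes the factor.\<close>
    from functionals.subspace_scale[OF assms(6) this, of "inverse c"]
    show ?thesis using c0 by (simp add: mult.assoc[symmetric])
  qed
  have "eta R p f \<in> V" for f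
    unfolding eta_eq_sum
  proof (rule functionals.subspace_sum[OF assms(6)])
    fix k
    show "(\<Sum>y\<in>solutions R p (nat \<bar>k\<bar>).
      (\<lambda>g. (of_real ((2 * pi)\<^sup>2) * cnj (modes f k y) / of_real (\<bar>nth_deriv p R y\<bar> powr (1 / real p))) * evaluation k y g)) \<in> V"
    proof (cases "finite (solutions R p (nat \<bar>k\<bar>))")
      case True
      then show ?thesis
        by (intro functionals.subspace_sum[OF assms(6)] functionals.subspace_scale[OF assms(6)] ev)
    qed (simp add: V0)
  qed
  then show "H_RAQ R p \<subseteq> V" by (auto simp: H_RAQ_def)
qed (rule assms(5))

end
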